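(* Let $r\ge 1$ be an integer and let $G$ be a connected graph with vertex set $V(G)=\{a_1,a_2,\dots,a_n\}$ ($n$ vertices, $n\geq 1$). Let $W(G)$ be the fully whiskered graph of $G$. Then $$\mathrm{Ind}_r(W(G))\simeq\begin{cases}\displaystyle\bigvee_{\binom{n-1}{r-n}}\mathbb{S}^{r-1}, & \text{if } n\leq r\leq 2n-1,\\ \{\mathrm{point}\}, & \text{otherwise.}\end{cases}$$
   Context: Graphs are finite, simple and undirected. For a graph $G$ and an integer $r\geq 1$, a subset $I\subseteq V(G)$ is $r$-independent if every connected component of the induced subgraph $G[I]$ has at most $r$ vertices. The $r$-independence complex $\mathrm{Ind}_r(G)$ is the simplicial complex on vertex set $V(G)$ whose simplices are all $r$-independent subsets of $V(G)$ (it is identified with its geometric realization). The fully whiskered graph $W(G)$ is obtained from $G$ by adding, for each vertex $v$ of $G$, one new vertex adjacent only to $v$. Here $\simeq$ denotes homotopy equivalence and $\bigvee_t \mathbb{S}^q$ denotes a wedge of $t$ copies of the $q$-sphere. *)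

theory Defs
  imports "HOL-Homology.Homology" "Graph_Theory.Digraph_Component"
begin

text \<open>
  A finite simple undirected graph is a \<^locale>\<open>pair_graph\<close>: a finite loop-free digraph whose arc set
  is a symmetric set of ordered pairs, an undirected edge being represented by its two orientations.
  Connected components are then the same as strongly connected components, whose vertex sets
  are collected in \<^const>\<open>pre_digraph.sccs_verts\<close>.
\<close>

definition r_independent :: "nat \<Rightarrow> 'a pair_pre_digraph \<Rightarrow> 'a set \<Rightarrow> bool" where
  "r_independent r G I \<longleftrightarrow>
     I \<subseteq> pverts G \<and> (\<forall>C \<in> pre_digraph.sccs_verts (with_proj G \<restriction> I). card C \<le> r)"

definition independence_complex :: "nat \<Rightarrow> 'a pair_pre_digraph \<Rightarrow> 'a set set" where
  "independence_complex r G = {I. r_independent r G I}"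

text \<open>\<open>Inl v\<close> is the original vertex \<open>v\<close> and \<open>Inr v\<close> is the whisker attached to it.\<close>

definition fully_whiskered :: "'a pair_pre_digraph \<Rightarrow> ('a + 'a) pair_pre_digraph" where
  "fully_whiskered G =
     \<lparr> pverts = Inl ` pverts G \<union> Inr ` pverts G,
       parcs = {(Inl u, Inl v) | u v. (u, v) \<in> parcs G}
             \<union> {(Inl v, Inr v) | v. v \<in> pverts G} \<union> {(Inr v, Inl v) | v. v \<in> pverts G} \<rparr>"

lemma pair_graph_fully_whiskered:
  assumes "pair_graph G"
  shows "pair_graph (fully_whiskered G)"
proof -
  interpret pair_graph G by fact
  have fin: "finite (parcs (fully_whiskered G))"
  proof (rule finite_subset)
    show "parcs (fully_whiskered G)
            \<subseteq> (Inl ` pverts G \<union> Inr ` pverts G) \<times> (Inl ` pverts G \<union> Inr ` pverts G)"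
      by (auto simp: fully_whiskered_def dest: in_arcsD1 in_arcsD2)
  qed (simp add: pair_finite_verts)
  have "sym (parcs G)"
    using pair_sym_arcs by (simp add: symmetric_def)
  then have "sym (parcs (fully_whiskered G))"
    by (auto simp: sym_def fully_whiskered_def)
  then have sym: "symmetric (with_proj (fully_whiskered G))"
    by (simp add: symmetric_def arcs_ends_def arc_to_ends_def with_proj_def)
  show ?thesis
    by unfold_locales
      (use fin sym no_loops in \<open>auto simp: fully_whiskered_def pair_finite_verts
         dest: in_arcsD1 in_arcsD2\<close>)
qed

text \<open>
  Barycentric coordinates. The topology is that of pointwise convergence, which is the usual
  topology of the realization when the complex has finitely many vertices. Points with infinite
  support are excluded because the sum of their coordinates is \<open>0\<close> by convention.
\<close>

definition geometric_realization :: "'a set set \<Rightarrow> ('a \<Rightarrow> real) topology" where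
  "geometric_realization K =
     subtopology (powertop_real UNIV)
       {x. (\<forall>v. 0 \<le> x v) \<and> {v. x v \<noteq> 0} \<in> K \<and> (\<Sum>v | x v \<noteq> 0. x v) = 1}"

text \<open>
  The wedge sum of pointed spaces \<open>(X i, p i)\<close>, \<open>i \<in> I\<close>: the quotient of the disjoint union that
  identifies all base points \<open>(i, p i)\<close> with the single point \<^const>\<open>None\<close>. The point \<^const>\<open>None\<close> is always
  present, so that the empty wedge is a one-point space.
\<close>

definition wedge_proj :: "('i \<Rightarrow> 'b) \<Rightarrow> 'i \<times> 'b \<Rightarrow> ('i \<times> 'b) option" where
  "wedge_proj p = (\<lambda>(i, x). if x = p i then None else Some (i, x))"

definition wedge_sum ::
    "('i \<Rightarrow> 'b topology) \<Rightarrow> ('i \<Rightarrow> 'b) \<Rightarrow> 'i set \<Rightarrow> ('i \<times> 'b) option topology" where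
  "wedge_sum X p I = topology (\<lambda>U.
     U \<subseteq> insert None (wedge_proj p ` topspace (sum_topology X I)) \<and>
     openin (sum_topology X I) {z \<in> topspace (sum_topology X I). wedge_proj p z \<in> U})"

lemma openin_wedge_sum:
  "openin (wedge_sum X p I) U \<longleftrightarrow>
     U \<subseteq> insert None (wedge_proj p ` topspace (sum_topology X I)) \<and>
     openin (sum_topology X I) {z \<in> topspace (sum_topology X I). wedge_proj p z \<in> U}"
proof -
  let ?T = "sum_topology X I"
  have Int: "{z \<in> topspace ?T. wedge_proj p z \<in> A \<inter> B} =
      {z \<in> topspace ?T. wedge_proj p z \<in> A} \<inter> {z \<in> topspace ?T. wedge_proj p z \<in> B}" for A B
    by auto
  have Un: "{z \<in> topspace ?T. wedge_proj p z \<in> \<Union>\<K>} =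
      (\<Union>A\<in>\<K>. {z \<in> topspace ?T. wedge_proj p z \<in> A})" for \<K>
    by auto
  have "istopology (\<lambda>U. U \<subseteq> insert None (wedge_proj p ` topspace ?T) \<and>
          openin ?T {z \<in> topspace ?T. wedge_proj p z \<in> U})"
    unfolding istopology_def Int Un by blast
  then show ?thesis
    by (simp add: wedge_sum_def)
qed

lemma topspace_wedge_sum:
  "topspace (wedge_sum X p I) = insert None (wedge_proj p ` topspace (sum_topology X I))"
proof
  show "topspace (wedge_sum X p I) \<subseteq> insert None (wedge_proj p ` topspace (sum_topology X I))"
    using openin_topspace[of "wedge_sum X p I"] by (simp only: openin_wedge_sum)
  have "{z \<in> topspace (sum_topology X I).
          wedge_proj p z \<in> insert None (wedge_proj p ` topspace (sum_topology X I))}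
        = topspace (sum_topology X I)"
    by auto
  then show "insert None (wedge_proj p ` topspace (sum_topology X I)) \<subseteq> topspace (wedge_sum X p I)"
    by (intro openin_subset) (simp only: openin_wedge_sum openin_topspace simp_thms subset_refl)
qed

lemma quotient_map_wedge_proj:
  assumes "I \<noteq> {}" and "\<And>i. i \<in> I \<Longrightarrow> p i \<in> topspace (X i)"
  shows "quotient_map (sum_topology X I) (wedge_sum X p I) (wedge_proj p)"
proof -
  obtain i where "i \<in> I" using assms(1) by blast
  then have "(i, p i) \<in> topspace (sum_topology X I)"
    using assms(2) by simp
  then have "None \<in> wedge_proj p ` topspace (sum_topology X I)"
    by (rule rev_image_eqI) (simp add: wedge_proj_def)
  then have "topspace (wedge_sum X p I) = wedge_proj p ` topspace (sum_topology X I)"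
    by (simp only: topspace_wedge_sum insert_absorb)
  then show ?thesis
    unfolding quotient_map_def
    by (simp add: openin_wedge_sum subset_insertI2 del: topspace_sum_topology)
qed

definition sphere_wedge :: "nat \<Rightarrow> nat \<Rightarrow> (nat \<times> (nat \<Rightarrow> real)) option topology" where
  "sphere_wedge t q = wedge_sum (\<lambda>_. nsphere q) (\<lambda>_ k. if k = 0 then 1 else 0) {..<t}"

end

theory Submission
  imports Defs "HOL-Analysis.Abstract_Topological_Spaces"
begin

text \<open>
  Let \<open>P\<close> be the vertex set of \<open>G\<close> and fix a vertex \<open>w \<in> P\<close>. As long as some original vertex \<open>v\<close> is
  missing from a simplex, the whisker of \<open>v\<close> is isolated and may be added freely, so the simplices
  that do not contain all of \<open>P\<close> form a contractible complex. A simplex that contains all of \<open>P\<close>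
  has the form \<open>P \<union> B\<close> for a set \<open>B\<close> of whiskers and induces a connected subgraph, hence is
  admissible if and only if \<open>n + card B \<le> r\<close>. Most of these can be paired off by adding or removing
  the whisker of \<open>w\<close>; the ones without a partner are the \<open>P \<union> B\<close> with \<open>w \<notin> B\<close> and \<open>card B = r - n\<close>.
  They exist precisely when \<open>n \<le> r \<le> 2 * n - 1\<close>, they have \<open>r\<close> vertices each, and there are
  \<open>(n - 1) choose (r - n)\<close> of them. Thus the complex is a contractible subcomplex \<open>L\<close>
  with that many simplices of dimension \<open>r - 1\<close> glued on along their boundaries, or just \<open>L\<close> when
  \<open>r\<close> is outside this range.

  Instead of performing the pairings one at a time as elementary collapses, \<open>L\<close> is contracted at one
  stroke (\<open>contractible_whisker_complex\<close>): cutting the weights of original vertices down by a small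
  threshold makes room for whiskers at all vertices whose weight was below the threshold, so that
  straight-line homotopies push everything onto the simplex of all whiskers.

  The wedge of spheres arises by collapsing \<open>L\<close> to a point. That this collapse is a
  homotopy equivalence is the usual consequence of the homotopy extension property
  (\<open>homotopy_equivalent_quotient_by_deformation\<close>), and both the extension
  (\<open>homotopy_extension\<close>) and the identification of a simplex modulo its boundary with a sphere
  (\<open>simplex_onto_sphere\<close>) are given by explicit formulas in barycentric coordinates.
\<close>

section \<open>Geometric realizations\<close>

lemma topspace_geometric_realization:
  assumes "finite V" and "K \<subseteq> Pow V"
  shows "x \<in> topspace (geometric_realization K) \<longleftrightarrow>
    (\<forall>v. 0 \<le> x v) \<and> {v. x v \<noteq> 0} \<in> K \<and> sum x V = 1"
proof -
  have "sum x {v. x v \<noteq> 0} = sum x V" if "{v. x v \<noteq> 0} \<in> K"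
    using that assms by (intro sum.mono_neutral_left) auto
  then show ?thesis
    by (auto simp: geometric_realization_def)
qed

lemma continuous_map_into_geometric_realization:
  assumes "\<And>v. continuous_map X euclideanreal (\<lambda>x. f x v)"
    and "\<And>x. x \<in> topspace X \<Longrightarrow> f x \<in> topspace (geometric_realization K)"
  shows "continuous_map X (geometric_realization K) f"
  using assms unfolding geometric_realization_def
  by (auto simp: continuous_map_in_subtopology continuous_map_componentwise_UNIV)

lemma continuous_map_coordinate:
  "continuous_map (geometric_realization K) euclideanreal (\<lambda>x. x v)"
  unfolding geometric_realization_def
  by (intro continuous_map_from_subtopology continuous_map_product_projection) simp

lemma continuous_map_coordinate_of:
  assumes "continuous_map X (geometric_realization K) f"
  shows "continuous_map X euclideanreal (\<lambda>x. f x v)"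
  using continuous_map_compose[OF assms continuous_map_coordinate[of K v]] by (simp add: comp_def)

lemma continuous_map_Min:
  assumes "finite S" "S \<noteq> {}" and "\<And>v. v \<in> S \<Longrightarrow> continuous_map X euclideanreal (\<lambda>x. f x v)"
  shows "continuous_map X euclideanreal (\<lambda>x. Min (f x ` S))"
  using assms
proof (induction S rule: finite_ne_induct)
  case (insert v S)
  have "(\<lambda>x. Min (f x ` insert v S)) = (\<lambda>x. min (f x v) (Min (f x ` S)))"
    using insert.hyps by (simp add: fun_eq_iff)
  then show ?case
    using insert by (simp add: continuous_map_real_min)
qed simp

definition normalize_on :: "'a set \<Rightarrow> ('a \<Rightarrow> real) \<Rightarrow> 'a \<Rightarrow> real" where
  "normalize_on V x = (\<lambda>v. x v / sum x V)"

lemma normalize_on_eq: "sum x V = 1 \<Longrightarrow> normalize_on V x = x"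
  by (simp add: normalize_on_def)

lemma normalize_on_in_geometric_realization:
  assumes "finite V" "K \<subseteq> Pow V" "\<And>v. 0 \<le> x v" "{v. x v \<noteq> 0} \<in> K" "0 < sum x V"
  shows "normalize_on V x \<in> topspace (geometric_realization K)"
  using assms
  by (simp add: topspace_geometric_realization normalize_on_def sum_divide_distrib[symmetric])

text \<open>
  Two maps into a realization are homotopic as soon as their values at each point lie in a common
  simplex, because the segment between them then stays in that simplex. The maps are given by
  unnormalized weights: rescaling happens along the segment, which spares the formulas below any
  normalization.
\<close>

lemma homotopic_straight_line:
  assumes V: "finite V" "K \<subseteq> Pow V"
    and down: "\<And>I J. I \<in> K \<Longrightarrow> J \<subseteq> I \<Longrightarrow> J \<in> K"
    and contf: "\<And>v. continuous_map X euclideanreal (\<lambda>x. f x v)"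
    and contg: "\<And>v. continuous_map X euclideanreal (\<lambda>x. g x v)"
    and nonneg: "\<And>x v. x \<in> topspace X \<Longrightarrow> 0 \<le> f x v" "\<And>x v. x \<in> topspace X \<Longrightarrow> 0 \<le> g x v"
    and pos: "\<And>x. x \<in> topspace X \<Longrightarrow> 0 < sum (f x) V" "\<And>x. x \<in> topspace X \<Longrightarrow> 0 < sum (g x) V"
    and carrier: "\<And>x. x \<in> topspace X \<Longrightarrow> {v. f x v \<noteq> 0} \<union> {v. g x v \<noteq> 0} \<in> K"
  shows "homotopic_with (\<lambda>_. True) X (geometric_realization K)
           (\<lambda>x. normalize_on V (f x)) (\<lambda>x. normalize_on V (g x))"
proof -
  define l where "l = (\<lambda>(t::real, x) v. (1 - t) * f x v + t * g x v)"
  let ?I = "prod_topology (top_of_set {0..1::real}) X"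
  have contl: "continuous_map ?I euclideanreal (\<lambda>z. l z v)" for v
    unfolding l_def case_prod_beta
    by (intro continuous_map_real_mult continuous_map_add continuous_map_diff
        continuous_map_compose[OF continuous_map_snd contf, unfolded comp_def]
        continuous_map_compose[OF continuous_map_snd contg, unfolded comp_def]
        continuous_map_into_fulltopology[OF continuous_map_fst]) simp
  have pos': "0 < sum (l z) V" if "z \<in> topspace ?I" for z
  proof -
    obtain t x where z: "z = (t, x)" by force
    with that have tx: "0 \<le> t" "t \<le> 1" "x \<in> topspace X" by auto
    have "sum (l z) V = (1 - t) * sum (f x) V + t * sum (g x) V"
      by (simp add: z l_def sum.distrib sum_distrib_left)
    moreover have "0 < (1 - t) * sum (f x) V + t * sum (g x) V"
    proof (cases "t = 0")
      case False
      then have "0 < t * sum (g x) V" using tx pos by simp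
      then show ?thesis
        using pos(1)[OF tx(3)] tx by (simp add: add_nonneg_pos)
    qed (use pos tx in simp)
    ultimately show ?thesis by simp
  qed
  then have nonzero: "sum (l z) V \<noteq> 0" if "z \<in> topspace ?I" for z
    using that by (metis less_irrefl)
  have "continuous_map ?I (geometric_realization K) (\<lambda>z. normalize_on V (l z))"
  proof (rule continuous_map_into_geometric_realization)
    fix v
    show "continuous_map ?I euclideanreal (\<lambda>z. normalize_on V (l z) v)"
      unfolding normalize_on_def
      by (intro continuous_map_real_divide continuous_map_sum contl V(1) nonzero)
  next
    fix z assume z: "z \<in> topspace ?I"
    then obtain t x where tx: "z = (t, x)" "0 \<le> t" "t \<le> 1" "x \<in> topspace X" by force
    have "{v. l z v \<noteq> 0} \<subseteq> {v. f x v \<noteq> 0} \<union> {v. g x v \<noteq> 0}"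
      by (auto simp: l_def tx)
    then have "{v. l z v \<noteq> 0} \<in> K"
      using carrier[OF tx(4)] down by blast
    moreover have "0 \<le> l z v" for v
      using nonneg tx by (simp add: l_def)
    ultimately show "normalize_on V (l z) \<in> topspace (geometric_realization K)"
      using V pos'[OF z] by (intro normalize_on_in_geometric_realization)
  qed
  moreover have "l (0, x) = f x" "l (1, x) = g x" for x
    by (auto simp: l_def)
  ultimately show ?thesis
    unfolding homotopic_with_def by (intro exI[of _ "\<lambda>z. normalize_on V (l z)"]) simp
qed

lemma compact_geometric_realization_Pow:
  assumes "finite \<sigma>"
  shows "compact_space (geometric_realization (Pow \<sigma>))"
proof -
  let ?P = "powertop_real (UNIV :: 'a set)" and ?Q = "PiE (UNIV :: 'a set) (\<lambda>_. {0..1::real})"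
  let ?T = "topspace (geometric_realization (Pow \<sigma>))"
  have "{x. \<forall>v. v \<notin> \<sigma> \<longrightarrow> x v = 0} = PiE UNIV (\<lambda>v. if v \<in> \<sigma> then UNIV else {0::real})"
    by (auto simp: PiE_iff split: if_splits)
  then have "closedin ?P {x. \<forall>v. v \<notin> \<sigma> \<longrightarrow> x v = 0}"
    by (simp add: closedin_product_topology)
  moreover have "closedin ?P {x \<in> topspace ?P. sum x \<sigma> \<in> {1}}"
    using assms by (intro closedin_continuous_map_preimage[of _ euclideanreal] continuous_map_sum
        continuous_map_product_projection) auto
  ultimately have cl: "closedin ?P ({x. \<forall>v. v \<notin> \<sigma> \<longrightarrow> x v = 0} \<inter> {x \<in> topspace ?P. sum x \<sigma> \<in> {1}})"
    by (rule closedin_Int)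
  have "compactin ?P ?Q"
    by (simp add: compactin_PiE)
  moreover have "?T = ?Q \<inter> ({x. \<forall>v. v \<notin> \<sigma> \<longrightarrow> x v = 0} \<inter> {x \<in> topspace ?P. sum x \<sigma> \<in> {1}})"
  proof -
    have "x v \<le> 1" if "\<And>v. 0 \<le> x v" "{v. x v \<noteq> 0} \<subseteq> \<sigma>" "sum x \<sigma> = 1" for x :: "'a \<Rightarrow> real" and v
    proof (cases "v \<in> \<sigma>")
      case True
      then show ?thesis using member_le_sum[of v \<sigma> x] that assms by simp
    next
      case False
      then show ?thesis using that(2) by force
    qed
    then show ?thesis
      using assms by (auto simp: topspace_geometric_realization[OF assms order_refl] PiE_iff)
  qed
  ultimately have "compactin ?P ?T"
    using compact_Int_closedin[OF _ cl] by simp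
  then have "compact_space (subtopology ?P ?T)"
    by (simp add: compact_space_subtopology)
  moreover have "subtopology ?P ?T = geometric_realization (Pow \<sigma>)"
    unfolding geometric_realization_def by simp
  ultimately show ?thesis by simp
qed

lemma subtopology_geometric_realization:
  assumes "K' \<subseteq> K"
  shows "subtopology (geometric_realization K) (topspace (geometric_realization K')) =
    geometric_realization K'"
  using assms unfolding geometric_realization_def
  by (auto simp: subtopology_subtopology intro!: arg_cong[of _ _ "subtopology _"])

text \<open>
  A point lies in the subcomplex if and only if its weights vanish outside one of the finitely many
  simplices of the subcomplex, and each of these conditions is closed.
\<close>

lemma closedin_geometric_realization:
  assumes "finite V" "K \<subseteq> Pow V" "K' \<subseteq> K"
    and down: "\<And>I J. I \<in> K' \<Longrightarrow> J \<subseteq> I \<Longrightarrow> J \<in> K'"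
  shows "closedin (geometric_realization K) (topspace (geometric_realization K'))"
proof -
  let ?X = "geometric_realization K"
  have "finite K'"
    using assms by (meson finite_Pow_iff finite_subset)
  have K': "K' \<subseteq> Pow V" using assms by blast
  have "topspace (geometric_realization K') =
      (\<Union>J\<in>K'. {x \<in> topspace ?X. (\<Sum>v\<in>V - J. x v) \<in> {0}})"
  proof (intro equalityI subsetI)
    fix x assume x: "x \<in> topspace (geometric_realization K')"
    then have "(\<Sum>v\<in>V - {v. x v \<noteq> 0}. x v) = 0" by (intro sum.neutral) auto
    then show "x \<in> (\<Union>J\<in>K'. {x \<in> topspace ?X. (\<Sum>v\<in>V - J. x v) \<in> {0}})"
      using x assms K' by (auto simp: topspace_geometric_realization intro!: bexI[of _ "{v. x v \<noteq> 0}"])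
  next
    fix x assume "x \<in> (\<Union>J\<in>K'. {x \<in> topspace ?X. (\<Sum>v\<in>V - J. x v) \<in> {0}})"
    then obtain J where J: "J \<in> K'" "x \<in> topspace ?X" "(\<Sum>v\<in>V - J. x v) = 0" by auto
    then have "\<forall>v\<in>V - J. x v = 0"
      using assms by (subst (asm) sum_nonneg_eq_0_iff) (auto simp: topspace_geometric_realization)
    then have "{v. x v \<noteq> 0} \<subseteq> J"
      using J(2) assms by (auto simp: topspace_geometric_realization)
    then show "x \<in> topspace (geometric_realization K')"
      using J down assms K' by (auto simp: topspace_geometric_realization)
  qed
  moreover have "closedin ?X {x \<in> topspace ?X. (\<Sum>v\<in>V - J. x v) \<in> {0}}" for J
    using assms by (intro closedin_continuous_map_preimage[of _ euclideanreal]
        continuous_map_sum continuous_map_coordinate) auto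
  ultimately show ?thesis
    using \<open>finite K'\<close> by (simp only:) (rule closedin_Union, auto)
qed

section \<open>Collapsing a subspace that contracts inside itself\<close>

text \<open>
  If \<open>F\<close> deforms \<open>X\<close> while contracting \<open>Y\<close> inside itself, then \<open>F (1, -)\<close> factors through the
  quotient \<open>q\<close> that identifies \<open>Y\<close> to a point, and this factor \<open>g\<close> is a homotopy inverse of \<open>q\<close>:
  \<open>F\<close> itself deforms the identity to \<open>g \<circ> q\<close>, and it descends to a deformation of the
  identity to \<open>q \<circ> g\<close>. The descent needs that the product of \<open>q\<close> with the compact interval is
  again a quotient map.
\<close>

lemma homotopy_equivalent_quotient_by_deformation:
  assumes q: "quotient_map X Z q"
    and contF: "continuous_map (prod_topology (top_of_set {0..1::real}) X) X F"
    and F0: "\<And>x. x \<in> topspace X \<Longrightarrow> F (0, x) = x"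
    and FY: "\<And>t x. 0 \<le> t \<Longrightarrow> t \<le> 1 \<Longrightarrow> x \<in> Y \<Longrightarrow> F (t, x) \<in> Y"
    and F1: "\<And>x. x \<in> Y \<Longrightarrow> F (1, x) = y"
    and inj: "\<And>x x'. \<lbrakk>x \<in> topspace X; x' \<in> topspace X; q x = q x'\<rbrakk> \<Longrightarrow> x = x' \<or> x \<in> Y \<and> x' \<in> Y"
    and qY: "\<And>x x'. x \<in> Y \<Longrightarrow> x' \<in> Y \<Longrightarrow> q x = q x'"
  shows "X homotopy_equivalent_space Z"
proof -
  let ?U = "top_of_set {0..1::real}"
  have contq: "continuous_map X Z q"
    using q by (rule quotient_imp_continuous_map)
  have slice: "continuous_map X X (\<lambda>x. F (t, x))" if "0 \<le> t" "t \<le> 1" for t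
  proof -
    have "continuous_map X (prod_topology ?U X) (\<lambda>x. (t, x))"
      using that by (simp add: continuous_map_pairwise comp_def)
    from continuous_map_compose[OF this contF] show ?thesis by (simp add: comp_def)
  qed
  have F1_eq: "\<And>x x'. \<lbrakk>x \<in> topspace X; x' \<in> topspace X; q x = q x'\<rbrakk> \<Longrightarrow> F (1, x) = F (1, x')"
    using inj F1 by metis
  obtain g where contg: "continuous_map Z X g"
    and g: "\<And>x. x \<in> topspace X \<Longrightarrow> g (q x) = F (1, x)"
    by (rule quotient_map_lift_exists[OF q slice[of 1] F1_eq]) simp_all
  have "homotopic_with (\<lambda>_. True) X X (\<lambda>x. F (0, x)) (\<lambda>x. F (1, x))"
    unfolding homotopic_with_def using contF by (intro exI[of _ F]) simp
  then have "homotopic_with (\<lambda>_. True) X X id (g \<circ> q)"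
    by (rule homotopic_with_eq) (auto simp: F0 g)
  then have gq: "homotopic_with (\<lambda>_. True) X X (g \<circ> q) id"
    by (subst homotopic_with_sym)
  have quot: "quotient_map (prod_topology ?U X) (prod_topology ?U Z) (\<lambda>(t, x). (t, q x))"
    using q by (intro quotient_map_prod_right)
      (auto simp: compact_imp_locally_compact_space compact_space_subtopology Hausdorff_space_subtopology)
  have contqF: "continuous_map (prod_topology ?U X) Z (q \<circ> F)"
    by (intro continuous_map_compose[OF contF contq])
  obtain H where contH: "continuous_map (prod_topology ?U Z) Z H"
    and H: "\<And>z. z \<in> topspace (prod_topology ?U X) \<Longrightarrow> H ((\<lambda>(t, x). (t, q x)) z) = (q \<circ> F) z"
  proof (rule quotient_map_lift_exists[OF quot contqF])
    fix z z' assume "z \<in> topspace (prod_topology ?U X)" "z' \<in> topspace (prod_topology ?U X)"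
      "(\<lambda>(t, x). (t, q x)) z = (\<lambda>(t, x). (t, q x)) z'"
    then obtain t x x' where "z = (t, x)" "z' = (t, x')" "0 \<le> t" "t \<le> 1"
      "x \<in> topspace X" "x' \<in> topspace X" "q x = q x'"
      by (cases z; cases z') auto
    then show "(q \<circ> F) z = (q \<circ> F) z'"
      using inj[of x x'] qY FY by auto
  qed blast
  have surj: "q ` topspace X = topspace Z"
    using q by (rule quotient_imp_surjective_map)
  have "homotopic_with (\<lambda>_. True) Z Z (\<lambda>z. H (0, z)) (\<lambda>z. H (1, z))"
    unfolding homotopic_with_def using contH by (intro exI[of _ H]) simp
  then have "homotopic_with (\<lambda>_. True) Z Z id (q \<circ> g)"
  proof (rule homotopic_with_eq)
    fix z assume "z \<in> topspace Z"
    then obtain x where x: "x \<in> topspace X" "z = q x" using surj by auto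
    show "id z = H (0, z)" using H[of "(0, x)"] x F0 by simp
    show "(q \<circ> g) z = H (1, z)" using H[of "(1, x)"] x g by simp
  qed simp
  then have qg: "homotopic_with (\<lambda>_. True) Z Z (q \<circ> g) id"
    by (subst homotopic_with_sym)
  show ?thesis
    unfolding homotopy_equivalent_space_def using contq contg gq qg by blast
qed

section \<open>A simplex modulo its boundary\<close>

abbreviation sphere_base :: "nat \<Rightarrow> real" where
  "sphere_base \<equiv> (\<lambda>k. if k = 0 then 1 else 0)"

lemma sum_centred_eq_0:
  assumes "bij_betw e {..<r} \<sigma>" "0 < r" "sum x \<sigma> = 1"
  shows "(\<Sum>j<r. x (e j) - 1 / real r) = 0"
  using assms by (simp add: sum_subtractf sum.reindex_bij_betw[OF assms(1), of x])

text \<open>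
  The simplex modulo its boundary is a sphere, with the boundary as base point. Surjectivity is required only away from the
  base point: for \<open>r = 1\<close> the boundary is empty, and the base point of the \<open>0\<close>-sphere is not attained.
\<close>

definition sphere_collapse :: "'a set \<Rightarrow> nat \<Rightarrow> (('a \<Rightarrow> real) \<Rightarrow> nat \<Rightarrow> real) \<Rightarrow> bool" where
  "sphere_collapse \<sigma> r q \<longleftrightarrow>
     continuous_map (geometric_realization (Pow \<sigma>)) (nsphere (r - 1)) q \<and>
     topspace (nsphere (r - 1)) - {sphere_base} \<subseteq> q ` topspace (geometric_realization (Pow \<sigma>)) \<and>
     (\<forall>x \<in> topspace (geometric_realization (Pow \<sigma>)). q x = sphere_base \<longleftrightarrow> {v. x v \<noteq> 0} \<noteq> \<sigma>) \<and>
     (\<forall>x \<in> topspace (geometric_realization (Pow \<sigma>)). \<forall>y \<in> topspace (geometric_realization (Pow \<sigma>)).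
        {v. x v \<noteq> 0} = \<sigma> \<longrightarrow> {v. y v \<noteq> 0} = \<sigma> \<longrightarrow> q x = q y \<longrightarrow> x = y)"

text \<open>
  Let \<open>u\<close> be the barycentric coordinates relative to the barycentre and \<open>s = r * Min x\<close>, which is
  \<open>1\<close> at the barycentre and \<open>0\<close> precisely on the boundary. Radial stretching \<open>u / s\<close>
  maps the open simplex onto the hyperplane of vectors with coordinate sum \<open>0\<close>; dropping coordinate \<open>0\<close>
  identifies the latter with Euclidean space of dimension \<open>r - 1\<close>, and inverse stereographic projection takes
  it onto the sphere without its pole. Clearing denominators by \<open>s\<^sup>2\<close> yields the
  formula for \<open>q\<close>, which extends continuously to the boundary.
\<close>

lemma simplex_onto_sphere:
  fixes \<sigma> :: "'a set"
  assumes \<sigma>: "finite \<sigma>" "card \<sigma> = r" "0 < r"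
  shows "\<exists>q. sphere_collapse \<sigma> r q"
proof -
  let ?X = "geometric_realization (Pow \<sigma>)"
  have "\<sigma> \<noteq> {}" using \<sigma> by auto
  obtain e where e: "bij_betw e {..<r} \<sigma>"
    using ex_bij_betw_nat_finite[OF \<sigma>(1)] \<sigma>(2) by (auto simp: atLeast0LessThan)
  then have e_in: "e j \<in> \<sigma>" if "j < r" for j
    using that by (auto simp: bij_betw_def)
  have split: "{..<r} = insert 0 {1..<r}" using \<sigma>(3) by auto
  define u where "u = (\<lambda>(x::'a \<Rightarrow> real) j. x (e j) - 1 / real r)"
  define s where "s = (\<lambda>x::'a \<Rightarrow> real. real r * Min (x ` \<sigma>))"
  define A where "A = (\<lambda>x. \<Sum>j\<in>{1..<r}. (u x j)\<^sup>2)"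
  define q where "q = (\<lambda>x j. if j = 0 then (A x - (s x)\<^sup>2) / (A x + (s x)\<^sup>2)
      else if j < r then 2 * s x * u x j / (A x + (s x)\<^sup>2) else 0)"
  have X: "x \<in> topspace ?X \<longleftrightarrow> (\<forall>v. 0 \<le> x v) \<and> {v. x v \<noteq> 0} \<subseteq> \<sigma> \<and> sum x \<sigma> = 1" for x
    using topspace_geometric_realization[OF \<sigma>(1) order_refl, of x] by simp
  have sum_u: "(\<Sum>j<r. u x j) = 0" if "x \<in> topspace ?X" for x
    using that sum_centred_eq_0[OF e \<sigma>(3)] by (simp add: u_def X)
  have Min_le_vertex: "Min (x ` \<sigma>) \<le> x (e j)" if "j < r" for x :: "'a \<Rightarrow> real" and j
    using e_in[OF that] \<sigma>(1) by simp
  have s_le: "s x \<le> 1 + real r * u x j" if "j < r" for x j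
    using Min_le_vertex[OF that, of x] \<sigma>(3) by (simp add: s_def u_def algebra_simps)
  have s_attained: "\<exists>j<r. s x = 1 + real r * u x j" for x
  proof -
    have "Min (x ` \<sigma>) \<in> x ` \<sigma>" using \<sigma>(1) \<open>\<sigma> \<noteq> {}\<close> by simp
    then obtain j where "j < r" "Min (x ` \<sigma>) = x (e j)"
      using e unfolding bij_betw_def by (metis imageE lessThan_iff)
    then show ?thesis using \<sigma>(3) by (auto simp: s_def u_def algebra_simps)
  qed
  have s_nonneg: "0 \<le> s x" if "x \<in> topspace ?X" for x
    using that \<sigma> \<open>\<sigma> \<noteq> {}\<close> by (simp add: s_def X)
  have s_0: "s x = 0 \<longleftrightarrow> {v. x v \<noteq> 0} \<noteq> \<sigma>" if "x \<in> topspace ?X" for x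
  proof
    assume "s x = 0"
    then have "Min (x ` \<sigma>) = 0" using \<sigma>(3) by (simp add: s_def)
    then have "0 \<in> x ` \<sigma>" using Min_in[of "x ` \<sigma>"] \<sigma>(1) \<open>\<sigma> \<noteq> {}\<close> by simp
    then show "{v. x v \<noteq> 0} \<noteq> \<sigma>" by auto
  next
    assume "{v. x v \<noteq> 0} \<noteq> \<sigma>"
    moreover have "{v. x v \<noteq> 0} \<subseteq> \<sigma>" using that by (simp add: X)
    ultimately obtain v where "v \<in> \<sigma>" "x v = 0" by blast
    then have "Min (x ` \<sigma>) \<le> x v" using \<sigma>(1) by simp
    then have "s x \<le> 0" using \<open>x v = 0\<close> by (simp add: s_def mult_nonneg_nonpos)
    then show "s x = 0" using s_nonneg[OF that] by simp
  qed
  \<comment> \<open>Without \<open>s\<close> the denominator vanishes only if all of \<open>u\<close> does, that is, at the barycentre,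
    where \<open>s = 1\<close>.\<close>
  have D_pos: "0 < A x + (s x)\<^sup>2" if x: "x \<in> topspace ?X" for x
  proof (rule ccontr)
    assume "\<not> 0 < A x + (s x)\<^sup>2"
    moreover have "0 \<le> A x" by (simp add: A_def sum_nonneg)
    moreover have "0 \<le> (s x)\<^sup>2" by simp
    ultimately have "A x = 0" "(s x)\<^sup>2 = 0" by linarith+
    then have "s x = 0" by simp
    have "u x j = 0" if "j \<in> {1..<r}" for j
      using that \<open>A x = 0\<close> by (simp add: A_def sum_nonneg_eq_0_iff)
    moreover from this have "u x 0 = 0"
      using sum_u[OF x] by (simp add: split)
    ultimately have "u x j = 0" if "j < r" for j
      using that by (cases "j = 0") auto
    then show False
      using s_attained[of x] \<open>s x = 0\<close> by auto
  qed
  have contu: "continuous_map ?X euclideanreal (\<lambda>x. u x j)" for j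
    unfolding u_def by (intro continuous_map_diff continuous_map_coordinate) simp
  have conts: "continuous_map ?X euclideanreal s"
    unfolding s_def by (intro continuous_map_real_mult continuous_map_Min continuous_map_coordinate
        \<sigma> \<open>\<sigma> \<noteq> {}\<close>) simp
  have contA: "continuous_map ?X euclideanreal A"
    unfolding A_def by (intro continuous_map_sum continuous_map_real_pow contu) simp
  have nz: "A x + (s x)\<^sup>2 \<noteq> 0" if "x \<in> topspace ?X" for x
    using D_pos[OF that] by simp
  have "continuous_map ?X euclideanreal (\<lambda>x. q x j)" for j
  proof -
    have "continuous_map ?X euclideanreal (\<lambda>x. (A x - (s x)\<^sup>2) / (A x + (s x)\<^sup>2))"
      by (intro continuous_map_real_divide continuous_map_add continuous_map_diff
          continuous_map_real_pow contA conts nz)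
    moreover have "continuous_map ?X euclideanreal (\<lambda>x. 2 * s x * u x j / (A x + (s x)\<^sup>2))"
      by (intro continuous_map_real_divide continuous_map_add continuous_map_real_mult
          continuous_map_real_pow contA conts contu nz) simp
    ultimately show ?thesis
      by (auto simp: q_def)
  qed
  moreover have "q x \<in> topspace (nsphere (r - 1))" if x: "x \<in> topspace ?X" for x
  proof -
    let ?D = "A x + (s x)\<^sup>2"
    have r: "{..r - 1} = insert 0 {1..<r}" using \<sigma>(3) by auto
    have "(\<Sum>j\<in>{1..<r}. (q x j)\<^sup>2) = (\<Sum>j\<in>{1..<r}. 4 * (s x)\<^sup>2 / ?D\<^sup>2 * (u x j)\<^sup>2)"
      by (intro sum.cong) (auto simp: q_def power_divide power_mult_distrib)
    also have "\<dots> = 4 * (s x)\<^sup>2 * A x / ?D\<^sup>2"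
      by (simp only: sum_distrib_left[symmetric]) (simp add: A_def)
    finally have "(\<Sum>j\<le>r - 1. (q x j)\<^sup>2) = ((A x - (s x)\<^sup>2)\<^sup>2 + 4 * (s x)\<^sup>2 * A x) / ?D\<^sup>2"
      unfolding r by (simp add: power_divide add_divide_distrib) (simp add: q_def power_divide)
    also have "(A x - (s x)\<^sup>2)\<^sup>2 + 4 * (s x)\<^sup>2 * A x = ?D\<^sup>2"
      by (simp add: power2_eq_square algebra_simps)
    finally have "(\<Sum>j\<le>r - 1. (q x j)\<^sup>2) = 1"
      using nz[OF x] by simp
    moreover have "q x i = 0" if "i > r - 1" for i
      using that by (auto simp: q_def)
    ultimately show ?thesis by (simp add: nsphere)
  qed
  ultimately have cont: "continuous_map ?X (nsphere (r - 1)) q"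
    by (auto simp: nsphere continuous_map_in_subtopology continuous_map_componentwise_UNIV)
  have base: "q x = sphere_base \<longleftrightarrow> {v. x v \<noteq> 0} \<noteq> \<sigma>" if x: "x \<in> topspace ?X" for x
  proof -
    have "q x = sphere_base \<longleftrightarrow> s x = 0"
    proof
      assume "q x = sphere_base"
      then have "q x 0 = 1" by simp
      then have "A x - (s x)\<^sup>2 = A x + (s x)\<^sup>2"
        using nz[OF x] by (simp add: q_def)
      then show "s x = 0" by simp
    next
      assume "s x = 0"
      then show "q x = sphere_base"
        using nz[OF x] by (auto simp: q_def fun_eq_iff)
    qed
    then show ?thesis using s_0[OF x] by simp
  qed
  have inj: "x = y" if x: "x \<in> topspace ?X" "{v. x v \<noteq> 0} = \<sigma>"
    and y: "y \<in> topspace ?X" "{v. y v \<noteq> 0} = \<sigma>" and eq: "q x = q y" for x y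
  proof -
    have pos: "0 < s x" "0 < s y"
      using s_0[OF x(1)] s_0[OF y(1)] s_nonneg[OF x(1)] s_nonneg[OF y(1)] x y by auto
    \<comment> \<open>Stereographic projection recovers \<open>u / s\<close>, so \<open>u\<close> is known up to a positive factor; since \<open>s - 1\<close> is
      positively homogeneous in \<open>u\<close>, the factor is \<open>1\<close>.\<close>
    have ratio: "u z j / s z = q z j / (1 - q z 0)"
      if "z \<in> topspace ?X" "0 < s z" "j \<in> {1..<r}" for z j
    proof -
      have "1 - q z 0 = 2 * (s z)\<^sup>2 / (A z + (s z)\<^sup>2)"
        using nz[OF that(1)] by (simp add: q_def field_simps)
      moreover have "q z j = 2 * s z * u z j / (A z + (s z)\<^sup>2)"
        using that(3) by (simp add: q_def)
      ultimately show ?thesis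
        using nz[OF that(1)] that(2) by (simp add: power2_eq_square)
    qed
    have same_ratio': "u x j / s x = u y j / s y" if "j \<in> {1..<r}" for j
      using ratio[OF x(1) pos(1) that] ratio[OF y(1) pos(2) that] eq by simp
    have u0: "u z 0 / s z = - (\<Sum>j\<in>{1..<r}. u z j / s z)" if "z \<in> topspace ?X" for z
    proof -
      have "u z 0 = - (\<Sum>j\<in>{1..<r}. u z j)"
        using sum_u[OF that] by (simp add: split)
      then show ?thesis by (simp add: sum_divide_distrib)
    qed
    have "u x 0 / s x = u y 0 / s y"
      using u0[OF x(1)] u0[OF y(1)] same_ratio' by simp
    then have same_ratio: "u x j / s x = u y j / s y" if "j < r" for j
      using that same_ratio'[of j] by (cases "j = 0") auto
    have le: "s b \<le> s a" if ab: "0 < s a" "0 < s b" and h: "\<And>j. j < r \<Longrightarrow> u a j / s a = u b j / s b" for a b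
    proof -
      obtain j where j: "j < r" "s a = 1 + real r * u a j" using s_attained by blast
      have eq_j: "u a j = s a * (u b j / s b)" using h[OF j(1)] ab by (simp add: field_simps)
      have "real r * u a j = s a * (real r * u b j / s b)" unfolding eq_j by simp
      then have "s a - 1 = s a * (real r * u b j / s b)" using j(2) by linarith
      moreover have "s a * ((s b - 1) / s b) \<le> s a * (real r * u b j / s b)"
        using s_le[OF j(1), of b] ab by (intro mult_left_mono divide_right_mono) auto
      ultimately have "s a * ((s b - 1) / s b) \<le> s a - 1" by simp
      then show ?thesis using ab by (simp add: field_simps)
    qed
    have s_eq: "s x = s y"
    proof (rule antisym)
      show "s x \<le> s y" by (rule le[OF pos(2,1) same_ratio[symmetric]])
      show "s y \<le> s x" by (rule le[OF pos same_ratio])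
    qed
    show ?thesis
    proof
      fix v
      show "x v = y v"
      proof (cases "v \<in> \<sigma>")
        case True
        then obtain j where "j < r" "v = e j" using e unfolding bij_betw_def by blast
        then show ?thesis using same_ratio[of j] s_eq pos by (simp add: u_def)
      next
        case False
        then have "x v = 0" "y v = 0" using x(2) y(2) by blast+
        then show ?thesis by simp
      qed
    qed
  qed
  have surj: "topspace (nsphere (r - 1)) - {sphere_base} \<subseteq> q ` topspace ?X"
  proof
    fix z assume "z \<in> topspace (nsphere (r - 1)) - {sphere_base}"
    then have z: "(\<Sum>j\<le>r - 1. (z j)\<^sup>2) = 1" "\<And>i. i > r - 1 \<Longrightarrow> z i = 0" "z \<noteq> sphere_base"
      by (auto simp: nsphere)
    have r: "{..r - 1} = insert 0 {1..<r}" using \<sigma>(3) by auto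
    define B where "B = (\<Sum>j\<in>{1..<r}. (z j)\<^sup>2)"
    have B: "B = 1 - (z 0)\<^sup>2" "0 \<le> B" using z(1) unfolding r by (simp_all add: B_def sum_nonneg)
    have z0: "z 0 < 1"
    proof (rule ccontr)
      assume "\<not> z 0 < 1"
      then have "1 \<le> (z 0)\<^sup>2" by simp
      then have "B = 0" "(z 0)\<^sup>2 = 1" using B by auto
      then have z1: "z 0 = 1" using \<open>\<not> z 0 < 1\<close> by (simp add: power2_eq_1_iff)
      have "z j = 0" if "j \<noteq> 0" for j
        using that z(2)[of j] \<open>B = 0\<close> \<sigma>(3) by (cases "j < r") (auto simp: B_def sum_nonneg_eq_0_iff)
      then have "z = sphere_base" using z1 by auto
      then show False using z(3) by simp
    qed
    \<comment> \<open>The preimage: project \<open>z\<close> stereographically to \<open>y\<close>, then shrink \<open>y\<close> radially; the scale \<open>\<mu>\<close>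
      solves \<open>\<mu> = 1 + r * \<mu> * M\<close>, so that it agrees with \<open>s\<close> at the resulting point.\<close>
    define y where "y = (\<lambda>j. if j = 0 then - (\<Sum>j\<in>{1..<r}. z j / (1 - z 0)) else z j / (1 - z 0))"
    define M where "M = Min (y ` {..<r})"
    have sum_y: "(\<Sum>j<r. y j) = 0"
      by (simp add: split) (simp add: y_def)
    have M_le: "M \<le> y j" if "j < r" for j using that by (simp add: M_def)
    have "real r * M \<le> 0"
      using sum_mono[of "{..<r}" "\<lambda>_. M" y] M_le sum_y by simp
    define \<mu> where "\<mu> = 1 / (1 - real r * M)"
    have \<mu>: "0 < \<mu>" "\<mu> * (1 - real r * M) = 1" using \<open>real r * M \<le> 0\<close> by (simp_all add: \<mu>_def)
    define f where "f = the_inv_into {..<r} e"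
    have f: "f (e j) = j" if "j < r" for j
      using that e by (simp add: f_def bij_betw_def the_inv_into_f_f)
    define x where "x = (\<lambda>v. if v \<in> \<sigma> then 1 / real r + \<mu> * y (f v) else 0)"
    have xe: "x (e j) = 1 / real r + \<mu> * y j" if "j < r" for j
      using that e_in f by (simp add: x_def)
    have low: "1 / real r + \<mu> * M = \<mu> / real r"
      using \<mu>(2) \<sigma>(3) by (simp add: field_simps)
    have \<sigma>_img: "\<sigma> = e ` {..<r}" using e by (simp add: bij_betw_def)
    have Min_x: "Min (x ` \<sigma>) = \<mu> / real r"
    proof (rule Min_eqI)
      show "finite (x ` \<sigma>)" using \<sigma>(1) by simp
      fix w assume "w \<in> x ` \<sigma>"
      then obtain j where "j < r" "w = x (e j)" using \<sigma>_img by auto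
      then show "\<mu> / real r \<le> w"
        using M_le[of j] \<mu>(1) xe[of j] by (simp add: low[symmetric])
    next
      have "M \<in> y ` {..<r}" using \<sigma>(3) by (auto simp: M_def intro!: Min_in)
      then obtain j where "j < r" "M = y j" by auto
      then have "\<mu> / real r = x (e j)" using xe low by simp
      then show "\<mu> / real r \<in> x ` \<sigma>" using e_in \<open>j < r\<close> by simp
    qed
    then have sx: "s x = \<mu>" using \<sigma>(3) by (simp add: s_def)
    have "sum x \<sigma> = (\<Sum>j<r. x (e j))"
      by (rule sum.reindex_bij_betw[OF e, symmetric])
    also have "\<dots> = (\<Sum>j<r. 1 / real r + \<mu> * y j)" using xe by simp
    also have "\<dots> = 1" using sum_y \<sigma>(3) by (simp add: sum.distrib sum_distrib_left[symmetric])
    finally have "sum x \<sigma> = 1" .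
    moreover have "0 \<le> x v" for v
    proof (cases "v \<in> \<sigma>")
      case True
      then have "Min (x ` \<sigma>) \<le> x v" using \<sigma>(1) by simp
      then show ?thesis using Min_x \<mu>(1) by (simp add: order_trans[rotated])
    qed (simp add: x_def)
    moreover have "{v. x v \<noteq> 0} \<subseteq> \<sigma>" by (auto simp: x_def)
    ultimately have x: "x \<in> topspace ?X" by (simp add: X)
    have ux: "u x j = \<mu> * (z j / (1 - z 0))" if "j \<in> {1..<r}" for j
      using that xe[of j] by (simp add: u_def y_def)
    then have "A x = (\<Sum>j\<in>{1..<r}. (\<mu> / (1 - z 0))\<^sup>2 * (z j)\<^sup>2)"
      unfolding A_def by (intro sum.cong) (auto simp: power_mult_distrib power_divide)
    then have Ax: "A x = (\<mu> / (1 - z 0))\<^sup>2 * B"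
      by (simp add: B_def sum_distrib_left)
    also have "\<dots> = \<mu>\<^sup>2 * ((1 + z 0) / (1 - z 0))"
    proof -
      have "B = (1 - z 0) * (1 + z 0)" using B by (simp add: power2_eq_square algebra_simps)
      then show ?thesis using z0 by (simp add: power2_eq_square)
    qed
    finally have Ax: "A x = \<mu>\<^sup>2 * ((1 + z 0) / (1 - z 0))" .
    have "A x + (s x)\<^sup>2 = \<mu>\<^sup>2 * ((1 + z 0) / (1 - z 0) + 1)"
      unfolding Ax sx by (simp add: algebra_simps)
    also have "(1 + z 0) / (1 - z 0) + 1 = 2 / (1 - z 0)" using z0 by (simp add: field_simps)
    finally have Dx: "A x + (s x)\<^sup>2 = \<mu>\<^sup>2 * (2 / (1 - z 0))" .
    have "A x - (s x)\<^sup>2 = \<mu>\<^sup>2 * ((1 + z 0) / (1 - z 0) - 1)"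
      unfolding Ax sx by (simp add: algebra_simps)
    also have "(1 + z 0) / (1 - z 0) - 1 = 2 * z 0 / (1 - z 0)" using z0 by (simp add: field_simps)
    finally have Ex: "A x - (s x)\<^sup>2 = \<mu>\<^sup>2 * (2 * z 0 / (1 - z 0))" .
    have "q x = z"
    proof
      fix j
      consider "j = 0" | "j \<in> {1..<r}" | "r \<le> j" "j \<noteq> 0" by force
      then show "q x j = z j"
      proof cases
        case 1
        then show ?thesis using z0 \<mu>(1) by (simp add: q_def Dx Ex)
      next
        case 2
        then show ?thesis using z0 \<mu>(1) ux[OF 2]
          by (simp add: q_def sx Dx[unfolded sx]) (simp add: power2_eq_square)
      next
        case 3
        then show ?thesis using z(2)[of j] \<sigma>(3) by (simp add: q_def)
      qed
    qed
    then show "z \<in> q ` topspace ?X" using x by blast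
  qed
  have "sphere_collapse \<sigma> r q"
    unfolding sphere_collapse_def by (intro conjI cont surj ballI impI base inj)
  then show ?thesis by blast
qed

section \<open>Attaching simplices to a contractible complex\<close>

text \<open>
  \<open>K\<close> arises from its subcomplex \<open>K'\<close> by attaching \<open>m\<close> cells of dimension \<open>r - 1\<close>, each of them a
  simplex whose boundary already lies in \<open>K'\<close>.
\<close>

locale simplex_attachment =
  fixes V :: "'a set" and K K' :: "'a set set" and \<sigma> :: "nat \<Rightarrow> 'a set" and m r :: nat
  assumes V: "finite V" "K \<subseteq> Pow V"
    and down: "\<And>I J. I \<in> K \<Longrightarrow> J \<subseteq> I \<Longrightarrow> J \<in> K"
    and K': "K' \<subseteq> K" "\<And>I J. I \<in> K' \<Longrightarrow> J \<subseteq> I \<Longrightarrow> J \<in> K'"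
    and new_faces: "K - K' = \<sigma> ` {..<m}" and inj: "inj_on \<sigma> {..<m}"
    and card: "\<And>i. i < m \<Longrightarrow> card (\<sigma> i) = r" and r: "0 < r"
    and boundary: "\<And>i J. i < m \<Longrightarrow> J \<subset> \<sigma> i \<Longrightarrow> J \<in> K'"
begin

abbreviation "X \<equiv> geometric_realization K"
abbreviation "Y \<equiv> geometric_realization K'"
abbreviation supp :: "('a \<Rightarrow> real) \<Rightarrow> 'a set" where "supp x \<equiv> {v. x v \<noteq> 0}"

lemma in_X: "x \<in> topspace X \<longleftrightarrow> (\<forall>v. 0 \<le> x v) \<and> supp x \<in> K \<and> sum x V = 1"
  by (rule topspace_geometric_realization[OF V])

lemma in_Y: "x \<in> topspace Y \<longleftrightarrow> (\<forall>v. 0 \<le> x v) \<and> supp x \<in> K' \<and> sum x V = 1"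
  using K'(1) V by (intro topspace_geometric_realization) auto

lemma Y_subset_X: "topspace Y \<subseteq> topspace X"
  using K'(1) by (auto simp: in_X in_Y)

lemma face:
  assumes "i < m"
  shows "\<sigma> i \<in> K" "\<sigma> i \<notin> K'" "\<sigma> i \<subseteq> V" "finite (\<sigma> i)" "\<sigma> i \<noteq> {}"
proof -
  show "\<sigma> i \<in> K" "\<sigma> i \<notin> K'" using assms new_faces by blast+
  then show "\<sigma> i \<subseteq> V" using V(2) by blast
  then show "finite (\<sigma> i)" "\<sigma> i \<noteq> {}" using V(1) finite_subset card[OF assms] r by auto
qed

lemma face_subset_face: "i < m \<Longrightarrow> j < m \<Longrightarrow> \<sigma> i \<subseteq> \<sigma> j \<Longrightarrow> i = j"
  using card_subset_eq[OF face(4)[of j], of "\<sigma> i"] card inj by (auto simp: inj_on_def)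

lemma point_cases:
  assumes "x \<in> topspace X"
  obtains "x \<in> topspace Y" | i where "i < m" "supp x = \<sigma> i"
proof (cases "supp x \<in> K'")
  case True
  then show ?thesis using assms that(1) by (simp add: in_X in_Y)
next
  case False
  then have "supp x \<in> \<sigma> ` {..<m}" using assms new_faces by (auto simp: in_X)
  then show ?thesis using that(2) by blast
qed

text \<open>
  Any homotopy of \<open>Y\<close> that starts at the identity extends to \<open>X\<close>. Write a point of the
  simplex \<open>\<sigma> i\<close> as \<open>s * b + (1 - s) * y\<close> with \<open>b\<close> the barycentre and \<open>y\<close> on the boundary. At time \<open>t\<close>,
  the part with \<open>s \<ge> t / 2\<close> is stretched linearly over the whole simplex, and the collar \<open>s \<le> t / 2\<close> is first
  projected to \<open>y\<close> and then moved by the given homotopy for the time \<open>t - 2 * s\<close>. Both the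
  stretching and the projection subtract \<open>min s (t / 2)\<close> times the barycentre and rescale, which is the
  map \<open>P\<close> below. Its formula makes sense on all of \<open>X\<close>, since
  at most one of the functions \<open>s i\<close> is nonzero at any point.
\<close>

lemma homotopy_extension:
  assumes conth: "continuous_map (prod_topology (top_of_set {0..1::real}) Y) Y h"
    and h: "\<And>x. h (0, x) = x"
  obtains F where "continuous_map (prod_topology (top_of_set {0..1::real}) X) X F"
    "\<And>x. x \<in> topspace X \<Longrightarrow> F (0, x) = x"
    "\<And>t x. 0 \<le> t \<Longrightarrow> x \<in> topspace Y \<Longrightarrow> F (t, x) = h (t, x)"
proof -
  let ?U = "top_of_set {0..1::real}"
  have cases: "x \<in> topspace Y \<or> (\<exists>i<m. supp x = \<sigma> i)" if "x \<in> topspace X" for x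
    using that by (rule point_cases) blast+
  define s where "s = (\<lambda>i (x::'a \<Rightarrow> real). real r * Min (x ` \<sigma> i))"
  define S where "S = (\<lambda>x. \<Sum>i<m. s i x)"
  define c where "c = (\<lambda>(t::real, x) v. \<Sum>i<m. min (s i x) (t / 2) * (if v \<in> \<sigma> i then 1 / real r else 0))"
  define C where "C = (\<lambda>(t::real, x). \<Sum>i<m. min (s i x) (t / 2))"
  define P where "P = (\<lambda>z v. (snd z v - c z v) / (1 - C z))"

  have s_nonneg: "0 \<le> s i x" if "i < m" "x \<in> topspace X" for i x
    using that face(4,5) by (simp add: s_def in_X)
  have s_0: "s i x = 0" if "i < m" "x \<in> topspace X" "\<not> \<sigma> i \<subseteq> supp x" for i x
  proof -
    from that(3) obtain v where "v \<in> \<sigma> i" "x v = 0" by blast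
    then have "Min (x ` \<sigma> i) \<le> x v" using face(4,5)[OF that(1)] by simp
    then have "s i x \<le> 0" using \<open>x v = 0\<close> by (simp add: s_def mult_nonneg_nonpos)
    then show ?thesis using s_nonneg[OF that(1,2)] by simp
  qed
  have on_Y: "s i x = 0" if "i < m" "x \<in> topspace Y" for i x
  proof (rule s_0)
    show "\<not> \<sigma> i \<subseteq> supp x"
      using that face[OF that(1)] K'(2) by (auto simp: in_Y)
  qed (use that Y_subset_X in auto)
  have others: "s j x = 0" if "i < m" "supp x = \<sigma> i" "j < m" "j \<noteq> i" "x \<in> topspace X" for i j x
    using that face_subset_face[of j i] by (intro s_0) auto
  have S_Y: "S x = 0" "C (t, x) = 0" "P (t, x) = x" if "x \<in> topspace Y" "0 \<le> t" for x t
  proof -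
    have "c (t, x) v = 0" for v using that on_Y by (simp add: c_def)
    moreover show "C (t, x) = 0" using that on_Y by (simp add: C_def)
    ultimately show "P (t, x) = x" by (simp add: P_def)
    show "S x = 0" using that on_Y by (simp add: S_def)
  qed
  have S_\<sigma>: "S x = s i x" "C (t, x) = min (s i x) (t / 2)"
    "c (t, x) v = min (s i x) (t / 2) * (if v \<in> \<sigma> i then 1 / real r else 0)"
    if "i < m" "supp x = \<sigma> i" "x \<in> topspace X" "0 \<le> t" for i x t v
  proof -
    have *: "(\<Sum>j<m. f j) = f i" if "\<And>j. j < m \<Longrightarrow> j \<noteq> i \<Longrightarrow> f j = 0" for f :: "nat \<Rightarrow> real"
      using \<open>i < m\<close> that by (subst sum.remove[of _ i]) (auto intro!: sum.neutral)
    show "S x = s i x" unfolding S_def using others[OF that(1,2) _ _ that(3)] by (intro *) auto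
    show "C (t, x) = min (s i x) (t / 2)"
      unfolding C_def using others[OF that(1,2) _ _ that(3)] that(4) by (simp, intro *) auto
    show "c (t, x) v = min (s i x) (t / 2) * (if v \<in> \<sigma> i then 1 / real r else 0)"
      unfolding c_def using others[OF that(1,2) _ _ that(3)] that(4) by (simp only: prod.case, intro *) auto
  qed
  have C_le: "C (t, x) \<le> 1 / 2" if "0 \<le> t" "t \<le> 1" "x \<in> topspace X" for t x
    using cases[OF that(3)] S_Y(2)[of x t] S_\<sigma>(2)[of _ x t] that by auto
  have P_sum: "sum (P (t, x)) V = 1" if "0 \<le> t" "t \<le> 1" "x \<in> topspace X" for t x
  proof -
    have "(\<Sum>v\<in>V. c (t, x) v) = (\<Sum>i<m. \<Sum>v\<in>V. min (s i x) (t / 2) * (if v \<in> \<sigma> i then 1 / real r else 0))"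
      unfolding c_def prod.case by (rule sum.swap)
    also have "\<dots> = (\<Sum>i<m. min (s i x) (t / 2))"
    proof (intro sum.cong refl)
      fix i assume "i \<in> {..<m}"
      then have "V \<inter> \<sigma> i = \<sigma> i" "card (\<sigma> i) = r" using face card by auto
      then have "(\<Sum>v\<in>V. if v \<in> \<sigma> i then 1 / real r else 0) = 1"
        using V(1) r by (simp add: sum.If_cases Int_def[symmetric])
      then show "(\<Sum>v\<in>V. min (s i x) (t / 2) * (if v \<in> \<sigma> i then 1 / real r else 0)) = min (s i x) (t / 2)"
        by (simp add: sum_distrib_left[symmetric])
    qed
    finally have "(\<Sum>v\<in>V. c (t, x) v) = C (t, x)" by (simp add: C_def)
    moreover have "sum x V = 1" using that by (simp add: in_X)
    ultimately have "(\<Sum>v\<in>V. x v - c (t, x) v) = 1 - C (t, x)" by (simp add: sum_subtractf)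
    then show ?thesis
      using C_le[OF that] by (simp add: P_def sum_divide_distrib[symmetric])
  qed
  have P_X: "P (t, x) \<in> topspace X" "2 * S x \<le> t \<Longrightarrow> P (t, x) \<in> topspace Y"
    if tx: "0 \<le> t" "t \<le> 1" "x \<in> topspace X" for t x
  proof -
    have "P (t, x) \<in> topspace X \<and> (2 * S x \<le> t \<longrightarrow> P (t, x) \<in> topspace Y)"
      using cases[OF tx(3)]
    proof (elim disjE exE conjE)
      assume "x \<in> topspace Y"
      then show ?thesis using S_Y(3)[of x t] tx by auto
    next
      fix i assume i: "i < m" "supp x = \<sigma> i"
      have c: "c (t, x) v = (if v \<in> \<sigma> i then min (s i x) (t / 2) / real r else 0)" for v
        using S_\<sigma>(3)[OF i tx(3,1), of v] by simp
      have Min_le: "s i x / real r \<le> x v" if "v \<in> \<sigma> i" for v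
        using that face(4,5)[OF i(1)] r by (simp add: s_def)
      have le: "c (t, x) v \<le> x v" for v
      proof (cases "v \<in> \<sigma> i")
        case True
        have "min (s i x) (t / 2) / real r \<le> s i x / real r"
          by (intro divide_right_mono) auto
        then show ?thesis using Min_le[OF True] True c by simp
      next
        case False
        then show ?thesis using c tx(3) by (simp add: in_X)
      qed
      have nonneg: "0 \<le> P (t, x) v" for v
        using le[of v] C_le[OF tx] by (simp add: P_def)
      have supp_P: "supp (P (t, x)) \<subseteq> \<sigma> i"
        using c i(2) by (auto simp: P_def)
      then have "supp (P (t, x)) \<in> K" using down face(1)[OF i(1)] by blast
      moreover have "supp (P (t, x)) \<in> K'" if "2 * S x \<le> t"
      proof -
        have "min (s i x) (t / 2) = s i x" using that S_\<sigma>(1)[OF i tx(3,1)] by simp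
        moreover have "Min (x ` \<sigma> i) \<in> x ` \<sigma> i" using face(4,5)[OF i(1)] by simp
        then obtain v where v: "v \<in> \<sigma> i" "x v = Min (x ` \<sigma> i)" by auto
        ultimately have "P (t, x) v = 0" using c[of v] r by (simp add: P_def s_def)
        then have "supp (P (t, x)) \<subset> \<sigma> i" using supp_P v(1) by blast
        then show ?thesis by (rule boundary[OF i(1)])
      qed
      ultimately show ?thesis
        using nonneg P_sum[OF tx] by (auto simp: in_X in_Y)
    qed
    then show "P (t, x) \<in> topspace X" "2 * S x \<le> t \<Longrightarrow> P (t, x) \<in> topspace Y" by auto
  qed

  define F where "F = (\<lambda>z. if 2 * S (snd z) \<le> fst z then h (fst z - 2 * S (snd z), P z) else P z)"

  let ?UX = "prod_topology ?U X"
  have contx: "continuous_map ?UX euclideanreal (\<lambda>z. snd z v)" for v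
    by (rule continuous_map_coordinate_of[OF continuous_map_snd])
  have contt: "continuous_map ?UX euclideanreal fst"
    by (intro continuous_map_into_fulltopology[OF continuous_map_fst])
  have conts: "continuous_map ?UX euclideanreal (\<lambda>z. s i (snd z))" if "i < m" for i
    unfolding s_def using that face(4,5)
    by (intro continuous_map_real_mult continuous_map_Min[where f = snd] contx) auto
  have contmin: "continuous_map ?UX euclideanreal (\<lambda>z. min (s i (snd z)) (fst z / 2))" if "i < m" for i
    by (intro continuous_map_real_min continuous_map_real_divide conts contt that) auto
  have contS: "continuous_map ?UX euclideanreal (\<lambda>z. 2 * S (snd z))"
    unfolding S_def by (intro continuous_map_real_mult continuous_map_sum conts) auto
  have contP: "continuous_map ?UX euclideanreal (\<lambda>z. P z v)" for v
    unfolding P_def c_def C_def case_prod_beta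
  proof (intro continuous_map_real_divide continuous_map_diff continuous_map_sum
      continuous_map_real_mult contx contmin)
    fix z assume "z \<in> topspace ?UX"
    then show "1 - (\<Sum>i<m. min (s i (snd z)) (fst z / 2)) \<noteq> 0"
      using C_le[of "fst z" "snd z"] by (auto simp: C_def)
  qed auto
  have contF: "continuous_map ?UX X F"
    unfolding F_def
  proof (rule continuous_map_cases_le[OF contS contt])
    let ?A = "subtopology ?UX {z \<in> topspace ?UX. 2 * S (snd z) \<le> fst z}"
    have "continuous_map ?A ?U (\<lambda>z. fst z - 2 * S (snd z))"
    proof -
      have "0 \<le> S x" if "x \<in> topspace X" for x
        unfolding S_def using s_nonneg that by (intro sum_nonneg) auto
      then have "fst z - 2 * S (snd z) \<in> {0..1}" if "z \<in> topspace ?A" for z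
        using that by force
      then show ?thesis
        using continuous_map_from_subtopology[OF continuous_map_diff[OF contt contS]]
        by (auto simp: continuous_map_in_subtopology)
    qed
    moreover have "continuous_map ?A Y P"
    proof (rule continuous_map_into_geometric_realization)
      fix z assume "z \<in> topspace ?A"
      then show "P z \<in> topspace Y"
        using P_X(2)[of "fst z" "snd z"] by auto
    qed (intro continuous_map_from_subtopology contP)
    ultimately have "continuous_map ?A (prod_topology ?U Y) (\<lambda>z. (fst z - 2 * S (snd z), P z))"
      by (simp add: continuous_map_pairwise comp_def)
    from continuous_map_compose[OF this conth]
    have "continuous_map ?A Y (\<lambda>z. h (fst z - 2 * S (snd z), P z))"
      by (simp add: comp_def)
    then have hY: "continuous_map ?A (subtopology X (topspace Y)) (\<lambda>z. h (fst z - 2 * S (snd z), P z))"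
      by (simp only: subtopology_geometric_realization[OF K'(1)])
    show "continuous_map ?A X (\<lambda>z. h (fst z - 2 * S (snd z), P z))"
      using hY by (rule continuous_map_into_fulltopology)
    show "continuous_map (subtopology ?UX {z \<in> topspace ?UX. fst z \<le> 2 * S (snd z)}) X P"
    proof (rule continuous_map_into_geometric_realization)
      fix z assume "z \<in> topspace (subtopology ?UX {z \<in> topspace ?UX. fst z \<le> 2 * S (snd z)})"
      then show "P z \<in> topspace X"
        using P_X(1)[of "fst z" "snd z"] by auto
    qed (intro continuous_map_from_subtopology contP)
    show "h (fst z - 2 * S (snd z), P z) = P z" if "2 * S (snd z) = fst z" for z
      using that h by simp
  qed
  have F_0: "F (0, x) = x" if x: "x \<in> topspace X" for x
  proof -
    have "P (0, x) = x"
      using cases[OF x]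
    proof (elim disjE exE conjE)
      assume "x \<in> topspace Y"
      then show ?thesis using S_Y(3)[of x 0] by simp
    next
      fix i assume i: "i < m" "supp x = \<sigma> i"
      have "min (s i x) (0 / 2) = 0" using s_nonneg[OF i(1) x] by simp
      then show ?thesis
        using S_\<sigma>(2,3)[OF i x, of 0] by (simp add: P_def fun_eq_iff)
    qed
    moreover have "h (- (2 * S x), x) = x" if "2 * S x \<le> 0"
    proof -
      have "0 \<le> S x" unfolding S_def using s_nonneg x by (intro sum_nonneg) auto
      then show ?thesis using that h by simp
    qed
    ultimately show ?thesis by (simp add: F_def)
  qed
  have F_Y: "F (t, x) = h (t, x)" if "0 \<le> t" "x \<in> topspace Y" for t x
    using S_Y[OF that(2,1)] that by (simp add: F_def)


  show thesis
    by (rule that[OF contF F_0 F_Y])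
qed

text \<open>
  The maps of the closed simplices to the spheres and the constant map on \<open>Y\<close> agree on overlaps, hence
  glue to a continuous map. It is a quotient map because each simplex is compact and so maps to its
  sphere by a closed map; the base point has to be treated separately, as it may fail to be
  in the image of the simplex.
\<close>

lemma collapse_quotient:
  assumes m: "0 < m" and nonempty: "topspace Y \<noteq> {}"
  obtains g where "quotient_map X (sphere_wedge m (r - 1)) g"
    "\<And>x. x \<in> topspace Y \<Longrightarrow> g x = None"
    "\<And>x x'. \<lbrakk>x \<in> topspace X; x' \<in> topspace X; g x = g x'\<rbrakk> \<Longrightarrow> x = x' \<or> x \<in> topspace Y \<and> x' \<in> topspace Y"
proof -
  have cases: "x \<in> topspace Y \<or> (\<exists>i<m. supp x = \<sigma> i)" if "x \<in> topspace X" for x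
    using that by (rule point_cases) blast+
  define q where "q = (\<lambda>i. SOME q. sphere_collapse (\<sigma> i) r q)"
  have "sphere_collapse (\<sigma> i) r (q i)" if "i < m" for i
    unfolding q_def by (rule someI_ex[OF simplex_onto_sphere[OF face(4)[OF that] card[OF that] r]])
  note q = this[unfolded sphere_collapse_def]
  have contq: "continuous_map (geometric_realization (Pow (\<sigma> i))) (nsphere (r - 1)) (q i)"
    and q_surj: "topspace (nsphere (r - 1)) - {sphere_base}
        \<subseteq> q i ` topspace (geometric_realization (Pow (\<sigma> i)))" if "i < m" for i
    using q[OF that] by auto
  have q_base: "q i x = sphere_base \<longleftrightarrow> supp x \<noteq> \<sigma> i"
    if "i < m" "x \<in> topspace (geometric_realization (Pow (\<sigma> i)))" for i x
    using q[OF that(1)] that(2) by auto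
  have q_inj: "x = y" if "i < m" "x \<in> topspace (geometric_realization (Pow (\<sigma> i)))"
    "y \<in> topspace (geometric_realization (Pow (\<sigma> i)))" "supp x = \<sigma> i" "supp y = \<sigma> i" "q i x = q i y" for i x y
    using q[OF that(1)] that(2-) by blast
  define \<Delta> where "\<Delta> = (\<lambda>i. geometric_realization (Pow (\<sigma> i)))"
  have \<Delta>_iff: "x \<in> topspace (\<Delta> i) \<longleftrightarrow> x \<in> topspace X \<and> supp x \<subseteq> \<sigma> i" if "i < m" for i x
  proof -
    have "Pow (\<sigma> i) \<subseteq> Pow V" using face(3)[OF that] by blast
    then show ?thesis
      using topspace_geometric_realization[OF V(1), of "Pow (\<sigma> i)" x] down face(1)[OF that]
      by (auto simp: \<Delta>_def in_X)
  qed
  have \<Delta>_sub: "subtopology X (topspace (\<Delta> i)) = \<Delta> i" if "i < m" for i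
    unfolding \<Delta>_def using down face(1)[OF that] by (intro subtopology_geometric_realization) blast
  define W where "W = sphere_wedge m (r - 1)"
  define J where "J = insert None (Some ` {..<m})"
  define T where "T = case_option (topspace Y) (\<lambda>i. topspace (\<Delta> i))"
  define f where "f = case_option (\<lambda>_. None) (\<lambda>i x. wedge_proj (\<lambda>_. sphere_base) (i, q i x))"
  have W_top: "topspace W = insert None (wedge_proj (\<lambda>_. sphere_base) ` ({..<m} \<times> topspace (nsphere (r - 1))))"
    by (simp add: W_def sphere_wedge_def topspace_wedge_sum)
  have cont_proj: "continuous_map (sum_topology (\<lambda>_. nsphere (r - 1)) {..<m}) W (wedge_proj (\<lambda>_. sphere_base))"
    unfolding W_def sphere_wedge_def using m in_topspace_nsphere
    by (intro quotient_imp_continuous_map quotient_map_wedge_proj) auto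
  obtain g where contg: "continuous_map X W g"
    and g: "\<And>x j. j \<in> J \<Longrightarrow> x \<in> topspace X \<inter> T j \<Longrightarrow> g x = f j x"
  proof (rule pasting_lemma_exists_closed[of J X T W f])
    show "finite J" by (simp add: J_def)
    show "topspace X \<subseteq> \<Union> (T ` J)"
    proof
      fix x assume x: "x \<in> topspace X"
      then consider "x \<in> topspace Y" | i where "i < m" "supp x = \<sigma> i" using cases by blast
      then show "x \<in> \<Union> (T ` J)"
      proof cases
        case 2
        then have "x \<in> topspace (\<Delta> i)" using x by (simp add: \<Delta>_iff)
        then show ?thesis using 2 by (auto simp: T_def J_def)
      qed (auto simp: T_def J_def)
    qed
    show "closedin X (T j)" if "j \<in> J" for j
    proof (cases j)
      case None
      then show ?thesis
        using closedin_geometric_realization[OF V K'] by (simp add: T_def)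
    next
      case (Some i)
      then have "i < m" using that by (auto simp: J_def)
      then have "Pow (\<sigma> i) \<subseteq> K" using down face(1) by blast
      then have "closedin X (topspace (\<Delta> i))"
        unfolding \<Delta>_def by (rule closedin_geometric_realization[OF V]) auto
      then show ?thesis using Some by (simp add: T_def)
    qed
    show "continuous_map (subtopology X (T j)) W (f j)" if "j \<in> J" for j
    proof (cases j)
      case None
      then show ?thesis by (simp add: f_def W_top)
    next
      case (Some i)
      then have i: "i < m" using that by (auto simp: J_def)
      have "continuous_map (\<Delta> i) (sum_topology (\<lambda>_. nsphere (r - 1)) {..<m}) ((\<lambda>y. (i, y)) \<circ> q i)"
        unfolding \<Delta>_def using i
        by (intro continuous_map_compose[OF contq[OF i]] continuous_map_component_injection) simp
      from continuous_map_compose[OF this cont_proj] show ?thesis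
        by (simp add: Some T_def \<Delta>_sub[OF i] f_def comp_def)
    qed
    have mixed: "f (Some i) x = None" if "i < m" "x \<in> topspace (\<Delta> i)" "supp x \<noteq> \<sigma> i" for i x
      using that q_base[of i x] by (simp add: f_def \<Delta>_def wedge_proj_def)
    have mixedY: "supp x \<noteq> \<sigma> i" if "i < m" "x \<in> topspace Y" for i x
      using that face[of i] by (auto simp: in_Y)
    show "f j x = f j' x" if "j \<in> J" "j' \<in> J" and x: "x \<in> topspace X \<inter> T j \<inter> T j'" for j j' x
    proof -
      have aux: "f j x = None" if "j \<in> J" "j' \<in> J" "j \<noteq> j'" "x \<in> T j" "x \<in> T j'" for j j'
      proof (cases j)
        case None
        then show ?thesis by (simp add: f_def)
      next
        case (Some i)
        then have i: "i < m" "x \<in> topspace (\<Delta> i)" using that by (auto simp: J_def T_def)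
        have "supp x \<noteq> \<sigma> i"
        proof (cases j')
          case None
          then show ?thesis using mixedY[OF i(1)] that by (simp add: T_def)
        next
          case (Some i')
          then have i': "i' < m" "x \<in> topspace (\<Delta> i')" "i \<noteq> i'"
            using that \<open>j = Some i\<close> by (auto simp: J_def T_def)
          show ?thesis
            using face_subset_face[OF i(1) i'(1)] i' by (auto simp: \<Delta>_iff)
        qed
        then show ?thesis using mixed[OF i] \<open>j = Some i\<close> by simp
      qed
      then show ?thesis
        using that by (cases "j = j'") (simp, metis IntE)
    qed
  qed blast
  have g_Y: "g x = None" if "x \<in> topspace Y" for x
    using g[of None x] that Y_subset_X by (auto simp: J_def T_def f_def)
  have g_\<Delta>: "g x = wedge_proj (\<lambda>_. sphere_base) (i, q i x)" if "i < m" "x \<in> topspace (\<Delta> i)" for i x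
    using g[of "Some i" x] that by (auto simp: J_def T_def f_def \<Delta>_iff)
  have g_interior: "g x = Some (i, q i x)" if "i < m" "x \<in> topspace X" "supp x = \<sigma> i" for i x
  proof -
    have x: "x \<in> topspace (\<Delta> i)" using that by (simp add: \<Delta>_iff)
    then have "q i x \<noteq> sphere_base" using q_base[OF that(1)] that(3) by (simp add: \<Delta>_def)
    then show ?thesis using g_\<Delta>[OF that(1) x] by (simp add: wedge_proj_def)
  qed
  have quot: "quotient_map X W g"
    unfolding quotient_map_def
  proof (intro conjI allI impI)
    obtain y0 where y0: "y0 \<in> topspace Y" using nonempty by blast
    show "g ` topspace X = topspace W"
    proof
      show "g ` topspace X \<subseteq> topspace W"
        using continuous_map_image_subset_topspace[OF contg] .
      show "topspace W \<subseteq> g ` topspace X"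
      proof
        fix w assume "w \<in> topspace W"
        then consider "w = None" | i z where "i < m" "z \<in> topspace (nsphere (r - 1))" "z \<noteq> sphere_base" "w = Some (i, z)"
          by (auto simp: W_top wedge_proj_def split: if_splits)
        then show "w \<in> g ` topspace X"
        proof cases
          case 1
          then show ?thesis using g_Y[OF y0] y0 Y_subset_X by (metis image_eqI subsetD)
        next
          case 2
          then obtain x where x: "x \<in> topspace (\<Delta> i)" "z = q i x" using q_surj[OF 2(1)] by (auto simp: \<Delta>_def)
          then have "g x = w" using g_\<Delta>[OF 2(1) x(1)] 2 by (simp add: wedge_proj_def)
          moreover have "x \<in> topspace X" using x(1) \<Delta>_iff[OF 2(1)] by simp
          ultimately show ?thesis by blast
        qed
      qed
    qed
    fix U assume U: "U \<subseteq> topspace W"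
    show "openin X {x \<in> topspace X. g x \<in> U} = openin W U"
    proof
      assume "openin W U"
      then show "openin X {x \<in> topspace X. g x \<in> U}"
        using contg by (simp add: continuous_map_def)
    next
      assume pre: "openin X {x \<in> topspace X. g x \<in> U}"
      let ?S = "nsphere (r - 1)"
      have "openin ?S {z \<in> topspace ?S. wedge_proj (\<lambda>_. sphere_base) (i, z) \<in> U}" if i: "i < m" for i
      proof -
        let ?D = "{x \<in> topspace (\<Delta> i). g x \<notin> U}" and ?B = "if None \<in> U then {} else {sphere_base}"
        have "openin (\<Delta> i) (topspace (\<Delta> i) \<inter> {x \<in> topspace X. g x \<in> U})"
          using pre \<Delta>_sub[OF i] by (metis openin_subtopology_Int2)
        then have "closedin (\<Delta> i) (topspace (\<Delta> i) - (topspace (\<Delta> i) \<inter> {x \<in> topspace X. g x \<in> U}))"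
          by blast
        also have "topspace (\<Delta> i) - (topspace (\<Delta> i) \<inter> {x \<in> topspace X. g x \<in> U}) = ?D"
          using \<Delta>_iff[OF i] by auto
        finally have D: "closedin (\<Delta> i) ?D" .
        have haus: "Hausdorff_space ?S"
          unfolding nsphere by (intro Hausdorff_space_subtopology) (simp add: Hausdorff_space_product_topology)
        have "closed_map (\<Delta> i) ?S (q i)"
          unfolding \<Delta>_def
          by (intro T1_Spaces.continuous_imp_closed_map contq i haus compact_geometric_realization_Pow face(4))
        then have "closedin ?S (q i ` ?D)"
          using D by (simp add: closed_map_def)
        moreover have "closedin ?S ?B"
          using in_topspace_nsphere haus by (simp add: closedin_Hausdorff_sing_eq)
        ultimately have "closedin ?S (q i ` ?D \<union> ?B)" by (rule closedin_Un)
        then have "openin ?S (topspace ?S - (q i ` ?D \<union> ?B))"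
          by blast
        also have "topspace ?S - (q i ` ?D \<union> ?B) = {z \<in> topspace ?S. wedge_proj (\<lambda>_. sphere_base) (i, z) \<in> U}"
        proof (intro equalityI subsetI)
          fix z assume z: "z \<in> topspace ?S - (q i ` ?D \<union> ?B)"
          show "z \<in> {z \<in> topspace ?S. wedge_proj (\<lambda>_. sphere_base) (i, z) \<in> U}"
          proof (cases "z = sphere_base")
            case True
            then have "None \<in> U" using z by (auto split: if_splits)
            then show ?thesis using z True by (simp add: wedge_proj_def)
          next
            case False
            then obtain x where "x \<in> topspace (\<Delta> i)" "z = q i x" using q_surj[OF i] z by (auto simp: \<Delta>_def)
            then show ?thesis using z g_\<Delta>[OF i] by auto
          qed
        next
          fix z assume z: "z \<in> {z \<in> topspace ?S. wedge_proj (\<lambda>_. sphere_base) (i, z) \<in> U}"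
          then have "z \<notin> q i ` ?D" using g_\<Delta>[OF i] by auto
          moreover have "z \<notin> ?B" using z by (auto simp: wedge_proj_def)
          ultimately show "z \<in> topspace ?S - (q i ` ?D \<union> ?B)" using z by blast
        qed
        finally show ?thesis .
      qed
      then show "openin W U"
        using U unfolding W_def sphere_wedge_def openin_wedge_sum
        by (auto simp: openin_sum_topology topspace_wedge_sum)
    qed
  qed
  have g_inj: "x = x' \<or> x \<in> topspace Y \<and> x' \<in> topspace Y"
    if x: "x \<in> topspace X" "x' \<in> topspace X" and eq: "g x = g x'" for x x'
    using cases[OF x(1)] cases[OF x(2)]
  proof (elim disjE exE conjE)
    fix i i' assume i: "i < m" "supp x = \<sigma> i" "i' < m" "supp x' = \<sigma> i'"
    then have "i = i'" "q i x = q i' x'" using g_interior x eq by auto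
    moreover from this have "x \<in> topspace (\<Delta> i)" "x' \<in> topspace (\<Delta> i)"
      using i x by (simp_all add: \<Delta>_iff)
    ultimately show ?thesis
      using q_inj[of i x x'] i by (simp add: \<Delta>_def)
  qed (use g_Y g_interior x eq in auto)
  show thesis
    by (rule that[OF quot[unfolded W_def] g_Y g_inj])
qed

theorem homotopy_equivalent_sphere_wedge:
  assumes "0 < m" and contractible: "contractible_space Y" and nonempty: "topspace Y \<noteq> {}"
  shows "X homotopy_equivalent_space sphere_wedge m (r - 1)"
proof -
  let ?U = "top_of_set {0..1::real}"
  obtain a where "homotopic_with (\<lambda>_. True) Y Y id (\<lambda>_. a)"
    using contractible unfolding contractible_space_def by blast
  then obtain h where conth: "continuous_map (prod_topology ?U Y) Y h"
    and h: "\<And>x. h (0, x) = x" "\<And>x. h (1, x) = a"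
    unfolding homotopic_with_def by auto
  obtain F where F: "continuous_map (prod_topology ?U X) X F"
    "\<And>x. x \<in> topspace X \<Longrightarrow> F (0, x) = x"
    "\<And>t x. 0 \<le> t \<Longrightarrow> x \<in> topspace Y \<Longrightarrow> F (t, x) = h (t, x)"
    using homotopy_extension[OF conth h(1)] by blast
  obtain g where g: "quotient_map X (sphere_wedge m (r - 1)) g"
    "\<And>x. x \<in> topspace Y \<Longrightarrow> g x = None"
    "\<And>x x'. \<lbrakk>x \<in> topspace X; x' \<in> topspace X; g x = g x'\<rbrakk> \<Longrightarrow> x = x' \<or> x \<in> topspace Y \<and> x' \<in> topspace Y"
    using collapse_quotient[OF assms(1) nonempty] by blast
  show ?thesis
  proof (rule homotopy_equivalent_quotient_by_deformation[OF g(1) F(1,2) _ _ g(3)])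
    show "F (t, x) \<in> topspace Y" if "0 \<le> t" "t \<le> 1" "x \<in> topspace Y" for t x
    proof -
      have "(t, x) \<in> topspace (prod_topology ?U Y)" using that by simp
      then have "h (t, x) \<in> topspace Y"
        using continuous_map_image_subset_topspace[OF conth] by blast
      then show ?thesis using F(3) that by simp
    qed
    show "F (1, x) = a" if "x \<in> topspace Y" for x using F(3)[of 1 x] that h by simp
    show "g x = g x'" if "x \<in> topspace Y" "x' \<in> topspace Y" for x x' using that g(2) by simp
  qed
qed

end

section \<open>Complexes on the vertices of a whiskered graph\<close>

lemma sum_originals_whiskers:
  assumes "finite P"
  shows "sum f (Inl ` P \<union> Inr ` P) = (\<Sum>v\<in>P. f (Inl v)) + (\<Sum>v\<in>P. f (Inr v))"
  using assms by (subst sum.union_disjoint) (auto simp: sum.reindex)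

lemma insert_whiskers:
  assumes "finite B" "B \<subseteq> P" "I \<in> K" "\<And>v. v \<in> B \<Longrightarrow> Inl v \<notin> I"
    and "\<And>v I. v \<in> P \<Longrightarrow> Inl v \<notin> I \<Longrightarrow> I \<in> K \<Longrightarrow> insert (Inr v) I \<in> K"
  shows "I \<union> Inr ` B \<in> K"
  using assms(1,2,4)
proof induction
  case (insert v B)
  then have "insert (Inr v) (I \<union> Inr ` B) \<in> K" by (intro assms(5)) auto
  then show ?case by simp
qed (simp add: assms(3))

text \<open>
  The hypotheses \<open>whisker\<close> and \<open>whole\<close> say that a simplex can always be enlarged by a whisker: by
  that of any missing original vertex, or by that of \<open>w\<close> if none is missing. The map \<open>trunc\<close> lowers
  the weights of original vertices by \<open>\<tau>\<close>, and \<open>push\<close> puts weight on the whiskers of those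
  vertices whose weight is below \<open>\<tau>\<close>, and on the whisker of \<open>w\<close> if all original vertices have
  positive weight. So \<open>push\<close> vanishes nowhere, and it only uses whiskers that may be added to the
  truncated simplex. Moving from the identity to \<open>trunc\<close>, then to \<open>push\<close>, and finally inside the simplex of
  all whiskers to a vertex contracts the realization.
\<close>

lemma contractible_whisker_complex:
  fixes K :: "('a + 'a) set set"
  assumes P: "finite P" "w \<in> P"
    and K: "K \<subseteq> Pow (Inl ` P \<union> Inr ` P)" "{} \<in> K"
    and down: "\<And>I J. I \<in> K \<Longrightarrow> J \<subseteq> I \<Longrightarrow> J \<in> K"
    and whisker: "\<And>v I. v \<in> P \<Longrightarrow> Inl v \<notin> I \<Longrightarrow> I \<in> K \<Longrightarrow> insert (Inr v) I \<in> K"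
    and whole: "\<And>I. Inl ` P \<subseteq> I \<Longrightarrow> I \<in> K \<Longrightarrow> insert (Inr w) I \<in> K"
  shows "contractible_space (geometric_realization K)"
    and "topspace (geometric_realization K) \<noteq> {}"
proof -
  let ?V = "Inl ` P \<union> Inr ` P :: ('a + 'a) set"
  let ?X = "geometric_realization K"
  let ?supp = "\<lambda>x::'a + 'a \<Rightarrow> real. {z. x z \<noteq> 0}"
  have V: "finite ?V" using P by simp
  note X = topspace_geometric_realization[OF V K(1)]
  define \<tau> where "\<tau> = 1 / (2 * real (card P))"
  have "card P > 0" using P by (auto simp: card_gt_0_iff)
  then have \<tau>: "0 < \<tau>" "real (card P) * \<tau> = 1 / 2" by (simp_all add: \<tau>_def)
  define trunc where "trunc = (\<lambda>(x::'a + 'a \<Rightarrow> real) z.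
    case z of Inl v \<Rightarrow> max 0 (x (Inl v) - \<tau>) | Inr v \<Rightarrow> x (Inr v))"
  define push where "push = (\<lambda>(x::'a + 'a \<Rightarrow> real) (z::'a + 'a). case z of Inl v \<Rightarrow> 0
    | Inr v \<Rightarrow> (if v \<in> P then max 0 (\<tau> - x (Inl v)) else 0) + (if v = w then \<Prod>u\<in>P. x (Inl u) else 0))"
  define point where "point = (\<lambda>z::'a + 'a. if z = Inr w then 1 else (0::real))"
  have cont_trunc: "continuous_map ?X euclideanreal (\<lambda>x. trunc x z)" for z
    by (cases z) (simp_all add: trunc_def continuous_map_real_max continuous_map_diff continuous_map_coordinate)
  have cont_push: "continuous_map ?X euclideanreal (\<lambda>x. push x z)" for z
    using P by (cases z) (auto simp: push_def intro!: continuous_map_add continuous_map_prod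
        continuous_map_real_max continuous_map_diff continuous_map_coordinate)
  have trunc_nonneg: "0 \<le> trunc x z" and push_nonneg: "0 \<le> push x z" if "x \<in> topspace ?X" for x z
    using that by (auto simp: trunc_def push_def X prod_nonneg split: sum.split)
  \<comment> \<open>Truncation removes at most \<open>card P * \<tau> = 1 / 2\<close> of the total weight \<open>1\<close>.\<close>
  have trunc_pos: "0 < sum (trunc x) ?V" if "x \<in> topspace ?X" for x
  proof -
    have "1 - 1 / 2 = (\<Sum>v\<in>P. x (Inl v)) + (\<Sum>v\<in>P. x (Inr v)) - (\<Sum>v\<in>P. \<tau>)"
      using that \<tau> by (simp add: X sum_originals_whiskers[OF P(1)])
    also have "\<dots> = (\<Sum>v\<in>P. x (Inl v) - \<tau>) + (\<Sum>v\<in>P. x (Inr v))"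
      by (simp add: sum_subtractf)
    also have "\<dots> \<le> (\<Sum>v\<in>P. trunc x (Inl v)) + (\<Sum>v\<in>P. trunc x (Inr v))"
      by (intro add_mono sum_mono) (auto simp: trunc_def)
    finally show ?thesis by (simp add: sum_originals_whiskers[OF P(1)])
  qed
  have push_pos: "0 < sum (push x) ?V" if x: "x \<in> topspace ?X" for x
  proof -
    obtain v where v: "v \<in> P" "0 < push x (Inr v)"
    proof (cases "\<exists>v\<in>P. x (Inl v) = 0")
      case True
      then obtain v where v: "v \<in> P" "x (Inl v) = 0" by blast
      have "0 \<le> (\<Prod>u\<in>P. x (Inl u))" using x by (simp add: X prod_nonneg)
      then have "0 < push x (Inr v)" using v \<tau> by (simp add: push_def add_pos_nonneg)
      then show ?thesis using that v by blast
    next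
      case False
      then have "0 < (\<Prod>u\<in>P. x (Inl u))" using x by (intro prod_pos) (metis X order_less_le)
      then have "0 < push x (Inr w)" using P by (simp add: push_def add_nonneg_pos)
      then show ?thesis using that P by blast
    qed
    show ?thesis
      using v push_nonneg[OF x] by (intro sum_pos2[OF V, of "Inr v"]) auto
  qed
  have supp_trunc: "?supp (trunc x) \<subseteq> ?supp x" for x
  proof -
    have "trunc x z = 0" if "x z = 0" for z
      using that \<tau> by (cases z) (auto simp: trunc_def)
    then show ?thesis by blast
  qed
  have supp_push: "(\<exists>v\<in>P. z = Inr v \<and> x (Inl v) < \<tau>) \<or> z = Inr w \<and> (\<Prod>u\<in>P. x (Inl u)) \<noteq> 0"
    if "push x z \<noteq> 0" for x z
    using that by (cases z) (auto simp: push_def split: if_splits)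
  have carrier1: "?supp x \<union> ?supp (trunc x) \<in> K" if "x \<in> topspace ?X" for x
  proof -
    show ?thesis using that supp_trunc[of x] by (simp add: X Un_absorb2)
  qed
  have carrier2: "?supp (trunc x) \<union> ?supp (push x) \<in> K" if x: "x \<in> topspace ?X" for x
  proof -
    \<comment> \<open>\<open>A\<close> is the truncated simplex, with the whisker of \<open>w\<close> if \<open>push\<close> uses it for the second
      reason; \<open>B\<close> are the vertices that truncation removes even though they may lie in the support of \<open>x\<close>.\<close>
    define B where "B = {v \<in> P. x (Inl v) < \<tau>}"
    define A where "A = (if (\<Prod>u\<in>P. x (Inl u)) = 0 then ?supp (trunc x) else insert (Inr w) (?supp (trunc x)))"
    have "?supp x \<in> K" using x by (simp add: X)
    have "A \<in> K"
    proof (cases "(\<Prod>u\<in>P. x (Inl u)) = 0")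
      case True
      then show ?thesis
        using down[OF \<open>?supp x \<in> K\<close> supp_trunc] by (simp add: A_def)
    next
      case False
      then have "Inl ` P \<subseteq> ?supp x" using P(1) by auto
      then have "insert (Inr w) (?supp x) \<in> K" using whole \<open>?supp x \<in> K\<close> by simp
      moreover have "A \<subseteq> insert (Inr w) (?supp x)"
        using False supp_trunc by (auto simp: A_def)
      ultimately show ?thesis by (rule down)
    qed
    moreover have "Inl v \<notin> A" if "v \<in> B" for v
      using that by (auto simp: A_def B_def trunc_def)
    ultimately have "A \<union> Inr ` B \<in> K"
      using P(1) whisker by (intro insert_whiskers[of B P]) (auto simp: B_def)
    moreover have "?supp (trunc x) \<union> ?supp (push x) \<subseteq> A \<union> Inr ` B"
      using supp_push[of x] by (auto simp: A_def B_def)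
    ultimately show ?thesis by (rule down)
  qed
  have all_whiskers: "Inr ` P \<in> K"
    using insert_whiskers[of P P "{}" K] P(1) K(2) whisker by simp
  have carrier3: "?supp (push x) \<union> ?supp point \<in> K" for x
    using P(2) supp_push[of x] by (intro down[OF all_whiskers]) (auto simp: point_def split: if_splits)
  have point_pos: "0 < sum point ?V"
    using P by (intro sum_pos2[OF V, of "Inr w"]) (auto simp: point_def)
  have "homotopic_with (\<lambda>_. True) ?X ?X (\<lambda>x. normalize_on ?V x) (\<lambda>x. normalize_on ?V (trunc x))"
    using carrier1 trunc_nonneg trunc_pos
    by (intro homotopic_straight_line[OF V K(1) down] continuous_map_coordinate cont_trunc) (auto simp: X)
  moreover have "homotopic_with (\<lambda>_. True) ?X ?X (\<lambda>x. normalize_on ?V (trunc x)) (\<lambda>x. normalize_on ?V (push x))"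
    by (intro homotopic_straight_line[OF V K(1) down] cont_trunc cont_push trunc_nonneg push_nonneg
        trunc_pos push_pos carrier2)
  moreover have "homotopic_with (\<lambda>_. True) ?X ?X (\<lambda>x. normalize_on ?V (push x)) (\<lambda>x. normalize_on ?V point)"
    by (intro homotopic_straight_line[OF V K(1) down] cont_push push_nonneg push_pos carrier3 point_pos)
      (auto simp: point_def)
  ultimately have "homotopic_with (\<lambda>_. True) ?X ?X (\<lambda>x. normalize_on ?V x) (\<lambda>x. normalize_on ?V point)"
    using homotopic_with_trans by blast
  then have "homotopic_with (\<lambda>_. True) ?X ?X id (\<lambda>x. normalize_on ?V point)"
    by (rule homotopic_with_eq) (simp_all add: X normalize_on_eq)
  then show "contractible_space ?X"
    unfolding contractible_space_def by blast
  have "?supp point \<in> K" using carrier3 down by (metis Un_upper2)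
  then have "normalize_on ?V point \<in> topspace ?X"
    using point_pos by (intro normalize_on_in_geometric_realization V K(1)) (auto simp: point_def)
  then show "topspace ?X \<noteq> {}" by blast
qed

section \<open>Independent sets of a whiskered graph\<close>

text \<open>
  Bounding all mutually reachable sets is the same as bounding the strong components, but, unlike
  maximality, mutual reachability is visibly monotone in the inducing vertex set.
\<close>

definition mutually_reachable_in :: "('a, 'b) pre_digraph \<Rightarrow> 'a set \<Rightarrow> 'a set \<Rightarrow> bool" where
  "mutually_reachable_in G I C \<longleftrightarrow> (\<forall>u\<in>C. \<forall>v\<in>C. u \<rightarrow>\<^sup>*\<^bsub>G \<restriction> I\<^esub> v)"

lemma mutually_reachable_in_subset: "mutually_reachable_in G I C \<Longrightarrow> C \<subseteq> I"
  unfolding mutually_reachable_in_def reachable_def by (auto dest: in_rtrancl_on_in_F)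

lemma reachable_induce_mono:
  assumes "u \<rightarrow>\<^sup>*\<^bsub>G \<restriction> J\<^esub> v" "J \<subseteq> I"
  shows "u \<rightarrow>\<^sup>*\<^bsub>G \<restriction> I\<^esub> v"
  unfolding reachable_def
proof (rule rtrancl_on_mono[OF _ _ assms(1)[unfolded reachable_def]])
  show "arcs_ends (G \<restriction> J) \<subseteq> arcs_ends (G \<restriction> I)"
    unfolding arcs_ends_conv using assms(2) by auto
qed (use assms(2) in simp)

lemma r_independent_iff_mutually_reachable:
  assumes "finite (pverts G)"
  shows "r_independent r G I \<longleftrightarrow>
    I \<subseteq> pverts G \<and> (\<forall>C. mutually_reachable_in (with_proj G) I C \<longrightarrow> card C \<le> r)"
proof (cases "I \<subseteq> pverts G")
  case True
  let ?H = "with_proj G \<restriction> I"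
  have fin: "finite I" using True assms finite_subset by blast
  have "(\<forall>C \<in> pre_digraph.sccs_verts ?H. card C \<le> r) \<longleftrightarrow>
      (\<forall>C. mutually_reachable_in (with_proj G) I C \<longrightarrow> card C \<le> r)"
  proof safe
    fix C assume *: "\<forall>C \<in> pre_digraph.sccs_verts ?H. card C \<le> r"
      and C: "mutually_reachable_in (with_proj G) I C"
    show "card C \<le> r"
    proof (cases "C = {}")
      case False
      then obtain u where u: "u \<in> C" by blast
      define S where "S = {v. u \<rightarrow>\<^sup>*\<^bsub>?H\<^esub> v \<and> v \<rightarrow>\<^sup>*\<^bsub>?H\<^esub> u}"
      have trans: "\<And>x y z. x \<rightarrow>\<^sup>*\<^bsub>?H\<^esub> y \<Longrightarrow> y \<rightarrow>\<^sup>*\<^bsub>?H\<^esub> z \<Longrightarrow> x \<rightarrow>\<^sup>*\<^bsub>?H\<^esub> z"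
        unfolding reachable_def by (rule rtrancl_on_trans)
      have "C \<subseteq> S" using C u by (auto simp: S_def mutually_reachable_in_def)
      moreover have "S \<subseteq> I"
        unfolding S_def reachable_def by (auto dest: in_rtrancl_on_in_F)
      moreover have "S \<in> pre_digraph.sccs_verts ?H"
        unfolding pre_digraph.sccs_verts_def
        using u \<open>C \<subseteq> S\<close> by (auto simp: S_def dest: trans)
      ultimately show ?thesis
        using * fin by (meson card_mono finite_subset order_trans)
    qed simp
  next
    fix C assume "\<forall>C. mutually_reachable_in (with_proj G) I C \<longrightarrow> card C \<le> r"
      "C \<in> pre_digraph.sccs_verts ?H"
    then show "card C \<le> r"
      by (auto simp: pre_digraph.sccs_verts_def mutually_reachable_in_def)
  qed
  then show ?thesis using True by (simp add: r_independent_def)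
qed (simp add: r_independent_def)

lemma independence_complex_down_closed:
  assumes "finite (pverts G)" "I \<in> independence_complex r G" "J \<subseteq> I"
  shows "J \<in> independence_complex r G"
  using assms reachable_induce_mono[of "with_proj G" J _ _ I]
  by (auto simp: independence_complex_def r_independent_iff_mutually_reachable mutually_reachable_in_def)

lemma in_independence_complex_of_card:
  assumes "finite (pverts G)" "I \<subseteq> pverts G" "card I \<le> r"
  shows "I \<in> independence_complex r G"
  using assms mutually_reachable_in_subset[of "with_proj G" I]
  by (auto simp: independence_complex_def r_independent_iff_mutually_reachable
      intro: order_trans[OF card_mono] finite_subset)

lemma pverts_fully_whiskered: "pverts (fully_whiskered G) = Inl ` pverts G \<union> Inr ` pverts G"
  by (simp add: fully_whiskered_def)

text \<open>
  The only neighbour of the whisker of \<open>v\<close> is \<open>v\<close> itself. If \<open>v\<close> is absent, the whisker forms a component of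
  size \<open>1 \<le> r\<close> and the other components do not change.
\<close>

lemma insert_whisker_in_independence_complex:
  assumes fin: "finite (pverts G)" and "1 \<le> r" and v: "v \<in> pverts G" "Inl v \<notin> I"
    and I: "I \<in> independence_complex r (fully_whiskered G)"
  shows "insert (Inr v) I \<in> independence_complex r (fully_whiskered G)"
proof -
  let ?W = "with_proj (fully_whiskered G)"
  have finW: "finite (pverts (fully_whiskered G))"
    using fin by (simp add: pverts_fully_whiskered)
  have split: "x = y \<or> x \<rightarrow>\<^sup>*\<^bsub>?W \<restriction> I\<^esub> y" if "x \<rightarrow>\<^sup>*\<^bsub>?W \<restriction> insert (Inr v) I\<^esub> y" for x y
    using that unfolding reachable_def
  proof (induction rule: rtrancl_on_induct)
    case (step y z)
    have arc: "(y, z) \<in> parcs (fully_whiskered G)" and "y \<in> insert (Inr v) I" "z \<in> insert (Inr v) I"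
      using step.hyps by (auto simp: arcs_ends_conv)
    then have "y \<in> I" "z \<in> I"
      using v(2) by (auto simp: fully_whiskered_def)
    moreover from this have "(y, z) \<in> arcs_ends (?W \<restriction> I)"
      using arc by (auto simp: arcs_ends_conv image_iff)
    ultimately show ?case
      using step.IH by (auto intro: rtrancl_on_into_rtrancl_on)
  qed simp
  have "card C \<le> r" if C: "mutually_reachable_in ?W (insert (Inr v) I) C" for C
  proof (cases "mutually_reachable_in ?W I C")
    case True
    then show ?thesis
      using I finW by (simp add: independence_complex_def r_independent_iff_mutually_reachable)
  next
    case False
    then obtain x y where xy: "x \<in> C" "y \<in> C" "\<not> x \<rightarrow>\<^sup>*\<^bsub>?W \<restriction> I\<^esub> y"
      by (auto simp: mutually_reachable_in_def)
    then have "x = y" using C split by (auto simp: mutually_reachable_in_def)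
    have "x \<notin> I" using xy(3) \<open>x = y\<close> by (auto simp: reachable_def)
    have "C \<subseteq> {x}"
    proof
      fix z assume "z \<in> C"
      then have "x = z \<or> x \<rightarrow>\<^sup>*\<^bsub>?W \<restriction> I\<^esub> z"
        using C split xy(1) by (auto simp: mutually_reachable_in_def)
      then show "z \<in> {x}"
        using \<open>x \<notin> I\<close> by (auto simp: reachable_def dest: in_rtrancl_on_in_F)
    qed
    then have "card C \<le> 1" by (metis card_mono card.empty card_insert_disjoint finite.intros One_nat_def empty_iff)
    then show ?thesis using assms(2) by simp
  qed
  then show ?thesis
    using I v finW by (simp add: independence_complex_def r_independent_iff_mutually_reachable
        pverts_fully_whiskered)
qed

lemma whiskers_in_independence_complex:
  assumes "finite (pverts G)" "1 \<le> r" "B \<subseteq> pverts G"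
  shows "Inr ` B \<in> independence_complex r (fully_whiskered G)"
proof -
  have "finite B" using assms finite_subset by blast
  then show ?thesis
    using assms(3)
  proof induction
    case empty
    show ?case
      using assms by (intro in_independence_complex_of_card[simplified]) (simp_all add: pverts_fully_whiskered)
  next
    case (insert v B)
    then show ?case
      using assms insert_whisker_in_independence_complex[of G r v "Inr ` B"] by auto
  qed
qed

text \<open>
  All of \<open>G\<close> together with some whiskers induces a connected subgraph, whose only component is the
  whole set.
\<close>

lemma all_originals_in_independence_complex_iff:
  assumes G: "pair_graph G" "Digraph_Component.connected (with_proj G)" and B: "B \<subseteq> pverts G"
  shows "Inl ` pverts G \<union> Inr ` B \<in> independence_complex r (fully_whiskered G) \<longleftrightarrow>
    card (pverts G) + card B \<le> r"
proof -
  interpret pair_graph G by fact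
  let ?I = "Inl ` pverts G \<union> Inr ` B :: ('a + 'a) set"
  let ?H = "with_proj (fully_whiskered G) \<restriction> ?I"
  have fin: "finite (pverts G)" by (rule pair_finite_verts)
  then have "finite B" using B finite_subset by blast
  have card: "card ?I = card (pverts G) + card B"
    using fin \<open>finite B\<close> by (subst card_Un_disjoint) (auto simp: card_image)
  have sub: "?I \<subseteq> pverts (fully_whiskered G)"
    using B by (auto simp: pverts_fully_whiskered)
  have finW: "finite (pverts (fully_whiskered G))"
    using fin by (simp add: pverts_fully_whiskered)
  have "sym (parcs G)"
    using pair_sym_arcs by (simp add: symmetric_def)
  have trans: "\<And>x y z. x \<rightarrow>\<^sup>*\<^bsub>?H\<^esub> y \<Longrightarrow> y \<rightarrow>\<^sup>*\<^bsub>?H\<^esub> z \<Longrightarrow> x \<rightarrow>\<^sup>*\<^bsub>?H\<^esub> z"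
    unfolding reachable_def by (rule rtrancl_on_trans)
  have arc: "x \<rightarrow>\<^sup>*\<^bsub>?H\<^esub> y" if "(x, y) \<in> parcs (fully_whiskered G)" "x \<in> ?I" "y \<in> ?I" for x y
    unfolding reachable_def
    using that by (intro rtrancl_on_into_rtrancl_on[OF rtrancl_on_refl]) (auto simp: arcs_ends_conv)
  have orig: "Inl u \<rightarrow>\<^sup>*\<^bsub>?H\<^esub> Inl v" if "u \<in> pverts G" "v \<in> pverts G" for u v
  proof -
    have "u \<rightarrow>\<^sup>*\<^bsub>mk_symmetric (with_proj G)\<^esub> v"
      using G(2) that by (auto simp: Digraph_Component.connected_def strongly_connected_def)
    then show ?thesis
      unfolding reachable_def[of "mk_symmetric _"]
    proof (induction rule: rtrancl_on_induct)
      case base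
      then show ?case using that by (simp add: reachable_def)
    next
      case (step y z)
      then have yz: "y \<in> pverts G" "z \<in> pverts G" by auto
      have "(y, z) \<in> parcs G"
        using step.hyps(2) \<open>sym (parcs G)\<close>
        by (auto simp: mk_symmetric_def arcs_ends_conv sym_def)
      then have "(Inl y, Inl z) \<in> parcs (fully_whiskered G)"
        by (simp add: fully_whiskered_def)
      then show ?case
        using step.IH arc yz trans by blast
    qed
  qed
  have root: "\<exists>u\<in>pverts G. x \<rightarrow>\<^sup>*\<^bsub>?H\<^esub> Inl u \<and> Inl u \<rightarrow>\<^sup>*\<^bsub>?H\<^esub> x" if "x \<in> ?I" for x
  proof (cases x)
    case (Inl u)
    then show ?thesis using that orig by blast
  next
    case (Inr u)
    then have "u \<in> B" "u \<in> pverts G" using that B by auto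
    then have "(x, Inl u) \<in> parcs (fully_whiskered G)" "(Inl u, x) \<in> parcs (fully_whiskered G)"
      using Inr by (auto simp: fully_whiskered_def)
    then have "x \<rightarrow>\<^sup>*\<^bsub>?H\<^esub> Inl u" "Inl u \<rightarrow>\<^sup>*\<^bsub>?H\<^esub> x"
      using \<open>u \<in> pverts G\<close> that by (auto intro!: arc)
    then show ?thesis using \<open>u \<in> pverts G\<close> by blast
  qed
  have "mutually_reachable_in (with_proj (fully_whiskered G)) ?I ?I"
    unfolding mutually_reachable_in_def
  proof (intro ballI)
    fix x y assume "x \<in> ?I" "y \<in> ?I"
    then show "x \<rightarrow>\<^sup>*\<^bsub>?H\<^esub> y"
      using root[of x] root[of y] orig trans by meson
  qed
  then have "card ?I \<le> r" if "?I \<in> independence_complex r (fully_whiskered G)"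
    using that finW by (simp add: independence_complex_def r_independent_iff_mutually_reachable)
  then show ?thesis
    using card in_independence_complex_of_card[OF finW sub, of r] by auto
qed

section \<open>The homotopy type of the independence complex\<close>

lemma contractible_imp_homotopy_equivalent_point:
  assumes "contractible_space X" "topspace X \<noteq> {}"
  shows "X homotopy_equivalent_space discrete_topology {()}"
proof -
  obtain a where a: "a \<in> topspace X" "X homotopy_equivalent_space subtopology X {a}"
    using assms by (auto simp: contractible_eq_homotopy_equivalent_singleton_subtopology)
  have "homeomorphic_maps (subtopology X {a}) (discrete_topology {()}) (\<lambda>_. ()) (\<lambda>_. a)"
    using a(1) by (auto simp: homeomorphic_maps_def continuous_map_in_subtopology)
  then have "subtopology X {a} homeomorphic_space discrete_topology {()}"
    unfolding homeomorphic_space_def by blast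
  then show ?thesis
    using a(2) homeomorphic_imp_homotopy_equivalent_space homotopy_eqv_trans by blast
qed

theorem theorem3p8:
  fixes G :: "'a pair_pre_digraph" and r n :: nat
  assumes "r \<ge> 1"
    and "pair_graph G"
    and "Digraph_Component.connected (with_proj G)"
    and "card (pverts G) = n" and "n \<ge> 1"
  shows "(n \<le> r \<and> r \<le> 2 * n - 1 \<longrightarrow>
            geometric_realization (independence_complex r (fully_whiskered G))
              homotopy_equivalent_space sphere_wedge ((n - 1) choose (r - n)) (r - 1))
       \<and> (\<not> (n \<le> r \<and> r \<le> 2 * n - 1) \<longrightarrow>
            geometric_realization (independence_complex r (fully_whiskered G))
              homotopy_equivalent_space discrete_topology {()})"
proof -
  let ?P = "pverts G" and ?K = "independence_complex r (fully_whiskered G)"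
  let ?V = "Inl ` ?P \<union> Inr ` ?P :: ('a + 'a) set"
  interpret pair_graph G by fact
  have P: "finite ?P" by (rule pair_finite_verts)
  obtain w where w: "w \<in> ?P" using assms(4,5) by fastforce
  have finW: "finite (pverts (fully_whiskered G))" using P by (simp add: pverts_fully_whiskered)
  note down = independence_complex_down_closed[OF finW]
  have V: "finite ?V" using P by simp
  have KV: "?K \<subseteq> Pow ?V"
    by (auto simp: independence_complex_def r_independent_def pverts_fully_whiskered)
  note whisker = insert_whisker_in_independence_complex[OF P assms(1)]
  note whole = all_originals_in_independence_complex_iff[OF assms(2,3), of _ r, unfolded assms(4)]
  have decompose: "\<exists>B\<subseteq>?P. I = Inl ` ?P \<union> Inr ` B" if "Inl ` ?P \<subseteq> I" "I \<in> ?K" for I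
  proof -
    have "I \<subseteq> ?V" using that(2) KV by blast
    then show ?thesis using that(1) by (intro exI[of _ "{v. Inr v \<in> I}"]) auto
  qed
  \<comment> \<open>\<open>L\<close> consists of the simplices that miss an original vertex and of those, containing all original vertices,
    that are paired off by the whisker of \<open>w\<close>.\<close>
  define L where "L = {I \<in> ?K. Inl ` ?P \<subseteq> I \<longrightarrow> insert (Inr w) I \<in> ?K}"
  have L_down: "J \<in> L" if "I \<in> L" "J \<subseteq> I" for I J
  proof -
    have "J \<in> ?K" using that down by (auto simp: L_def)
    moreover have "insert (Inr w) J \<in> ?K" if "Inl ` ?P \<subseteq> J"
    proof (rule down)
      show "insert (Inr w) I \<in> ?K" using that \<open>J \<subseteq> I\<close> \<open>I \<in> L\<close> by (auto simp: L_def)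
    qed (use \<open>J \<subseteq> I\<close> in blast)
    ultimately show ?thesis by (simp add: L_def)
  qed
  have "{} \<in> ?K" by (rule in_independence_complex_of_card[OF finW]) auto
  then have "{} \<in> L" using w by (auto simp: L_def)
  have L_whisker: "insert (Inr v) I \<in> L" if "v \<in> ?P" "Inl v \<notin> I" "I \<in> L" for v I
    using that whisker by (auto simp: L_def)
  have L_whole: "insert (Inr w) I \<in> L" if "Inl ` ?P \<subseteq> I" "I \<in> L" for I
    using that by (auto simp: L_def)
  have LV: "L \<subseteq> Pow ?V" using KV by (auto simp: L_def)
  note contractible_L = contractible_whisker_complex[OF P w LV \<open>{} \<in> L\<close> L_down L_whisker L_whole]
  show ?thesis
  proof (intro conjI impI)
    assume r: "n \<le> r \<and> r \<le> 2 * n - 1"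
    define m where "m = (n - 1) choose (r - n)"
    have "0 < m" using r unfolding m_def by (intro zero_less_binomial) linarith
    let ?\<B> = "{B. B \<subseteq> ?P - {w} \<and> card B = r - n}"
    have "card ?\<B> = m"
      using n_subsets[of "?P - {w}" "r - n"] P w assms(4) by (simp add: m_def)
    moreover have "finite ?\<B>" using P by simp
    ultimately obtain \<beta> where \<beta>: "bij_betw \<beta> {..<m} ?\<B>"
      using ex_bij_betw_nat_finite[of ?\<B>] by (auto simp: atLeast0LessThan)
    define \<sigma> where "\<sigma> = (\<lambda>i. Inl ` ?P \<union> Inr ` \<beta> i)"
    have \<beta>_in: "\<beta> i \<subseteq> ?P" "w \<notin> \<beta> i" "card (\<beta> i) = r - n" "finite (\<beta> i)" if "i < m" for i
    proof -
      have "\<beta> i \<in> ?\<B>" using \<beta> that by (auto simp: bij_betw_def)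
      then show "\<beta> i \<subseteq> ?P" "w \<notin> \<beta> i" "card (\<beta> i) = r - n" by auto
      then show "finite (\<beta> i)" using P finite_subset by blast
    qed
    have \<sigma>_K: "\<sigma> i \<in> ?K" if "i < m" for i
      using whole[OF \<beta>_in(1)[OF that]] \<beta>_in(3)[OF that] r by (simp add: \<sigma>_def)
    have attach: "simplex_attachment ?V ?K L \<sigma> m r"
    proof (rule simplex_attachment.intro[OF V KV down _ L_down])
      show "L \<subseteq> ?K" by (auto simp: L_def)
      show "?K - L = \<sigma> ` {..<m}"
      proof (intro equalityI subsetI)
        fix I assume I: "I \<in> ?K - L"
        then have "Inl ` ?P \<subseteq> I" "insert (Inr w) I \<notin> ?K" by (auto simp: L_def)
        then obtain B where B: "B \<subseteq> ?P" "I = Inl ` ?P \<union> Inr ` B" using decompose[of I] I by auto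
        have le: "n + card B \<le> r" using I whole[OF B(1)] B(2) by simp
        have "insert (Inr w) I = Inl ` ?P \<union> Inr ` insert w B" using B by auto
        then have gt: "\<not> n + card (insert w B) \<le> r"
          using \<open>insert (Inr w) I \<notin> ?K\<close> whole[of "insert w B"] B w by simp
        have "finite B" using B P finite_subset by blast
        then have "w \<notin> B" using le gt by (auto simp: insert_absorb)
        moreover from this have "card B = r - n" using le gt \<open>finite B\<close> by simp
        ultimately have "B \<in> ?\<B>" using B by blast
        then have "B \<in> \<beta> ` {..<m}" using \<beta> by (simp add: bij_betw_def)
        then obtain i where "i < m" "B = \<beta> i" by auto
        then show "I \<in> \<sigma> ` {..<m}" using B by (auto simp: \<sigma>_def)
      next
        fix I assume "I \<in> \<sigma> ` {..<m}"
        then obtain i where i: "i < m" "I = \<sigma> i" by auto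
        have "insert (Inr w) I = Inl ` ?P \<union> Inr ` insert w (\<beta> i)" using i by (auto simp: \<sigma>_def)
        then have "insert (Inr w) I \<notin> ?K"
          using whole[of "insert w (\<beta> i)"] \<beta>_in[OF i(1)] w r by simp
        then show "I \<in> ?K - L" using i \<sigma>_K[OF i(1)] by (auto simp: L_def \<sigma>_def)
      qed
      show "inj_on \<sigma> {..<m}"
      proof (rule inj_onI)
        fix i j assume "i \<in> {..<m}" "j \<in> {..<m}" "\<sigma> i = \<sigma> j"
        moreover from this have "\<beta> i = \<beta> j" by (auto simp: \<sigma>_def)
        ultimately show "i = j" using \<beta> by (auto simp: bij_betw_def inj_on_def)
      qed
      show "card (\<sigma> i) = r" if "i < m" for i
        using \<beta>_in[OF that] P r assms(4) unfolding \<sigma>_def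
        by (subst card_Un_disjoint) (auto simp: card_image)
      show "0 < r" using assms(1) by simp
      show "J \<in> L" if "i < m" "J \<subset> \<sigma> i" for i J
      proof -
        have "J \<in> ?K" using down[OF \<sigma>_K[OF that(1)]] that(2) by blast
        moreover have "insert (Inr w) J \<in> ?K" if "Inl ` ?P \<subseteq> J"
        proof -
          from decompose[OF that \<open>J \<in> ?K\<close>]
          obtain B where B: "B \<subseteq> ?P" "J = Inl ` ?P \<union> Inr ` B" by auto
          then have "B \<subset> \<beta> i" using \<open>J \<subset> \<sigma> i\<close> by (auto simp: \<sigma>_def)
          then have "card B < r - n" using psubset_card_mono[of "\<beta> i" B] \<beta>_in[OF \<open>i < m\<close>] by simp
          moreover have "card (insert w B) \<le> Suc (card B)" by (rule card_insert_le_m1) auto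
          ultimately have "n + card (insert w B) \<le> r" by linarith
          moreover have "insert (Inr w) J = Inl ` ?P \<union> Inr ` insert w B" using B by auto
          ultimately show ?thesis using whole[of "insert w B"] B w by simp
        qed
        ultimately show ?thesis by (simp add: L_def)
      qed
    qed
    show "geometric_realization ?K homotopy_equivalent_space sphere_wedge ((n - 1) choose (r - n)) (r - 1)"
      using simplex_attachment.homotopy_equivalent_sphere_wedge[OF attach \<open>0 < m\<close> contractible_L] by (simp add: m_def)
  next
    assume r: "\<not> (n \<le> r \<and> r \<le> 2 * n - 1)"
    \<comment> \<open>No simplex is left over: either \<open>r < n\<close> and none contains all original vertices, or \<open>2 * n \<le> r\<close> and
      all sets of vertices are simplices.\<close>
    have "I \<in> L" if "I \<in> ?K" for I
    proof -
      have "insert (Inr w) I \<in> ?K" if "Inl ` ?P \<subseteq> I"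
      proof -
        from decompose[OF that \<open>I \<in> ?K\<close>]
        obtain B where B: "B \<subseteq> ?P" "I = Inl ` ?P \<union> Inr ` B" by auto
        have "n + card B \<le> r" using \<open>I \<in> ?K\<close> whole[OF B(1)] B(2) by simp
        then have "2 * n \<le> r" using r by linarith
        moreover have "card (insert w B) \<le> n"
          using card_mono[of ?P "insert w B"] P B w assms(4) by simp
        moreover have "insert (Inr w) I = Inl ` ?P \<union> Inr ` insert w B" using B by auto
        ultimately show ?thesis using whole[of "insert w B"] B w by simp
      qed
      then show ?thesis using that by (simp add: L_def)
    qed
    then have "L = ?K" by (auto simp: L_def)
    then show "geometric_realization ?K homotopy_equivalent_space discrete_topology {()}"
      using contractible_imp_homotopy_equivalent_point[OF contractible_L] by simp
  qed
qed

end
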